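(* Work in the theory EZF described in the context, together with the axiom of choice for Zermelo sets. There is no CH-cardinal number $\beta$ such that $\aleph_0<\beta<\mathfrak{c}$, where $\aleph_0=|\mathbb{N}|_{ch}$ is the CH-cardinality of a countable set and $\mathfrak{c}=|P(\mathbb{N})|_{ch}$ is the CH-cardinality of the continuum.
   Context: The theory EZF: the language of ZF augmented with a second binary relation symbol $\in_1$ ("subset-membership"). $\mathcal{V}$ denotes the von Neumann universe; its members are called Zermelo sets, and $\mathcal{V}^*=\mathcal{V}\setminus\{\emptyset\}$. Axioms: the ZF axioms other than Power Set (null set, foundation, pairing, union, infinity, separation, replacement) with all quantifiers relativized to $\mathcal{V}$; Extensionality: for all $A,B\in\mathcal V$, if for every $S\in\mathcal V$ ($S\in_1 A\Leftrightarrow S\in_1 B$), then $A=B$; Powerset: for every object $X$ there is $Y\in\mathcal V$ with $\forall A\in\mathcal V\,(A\in_1 X\Leftrightarrow A\in Y)$, this $Y$ being written $P(X)$; Inverse powerset: for every $Y\in\mathcal V^*$ there is an object $X$ with $\forall A\in\mathcal V\,(A\in Y\Leftrightarrow A\in_1 X)$, this $X$ being written $P^{-1}(Y)$; Subset assignment: for all $X,A\in\mathcal V$, $\forall x(x\in A\Rightarrow x\in X)\Leftrightarrow A\in_1 X$. The class EZF consists of all Zermelo sets together with all $P^{-1}(X)$ for $X\in\mathcal V^*$; members of EZF not in $\mathcal V$ are called non-Zermelo. Extended subset relation: $X\subseteq Y$ iff either ($X,Y\in\mathcal V$ and every $A\in\mathcal V$ with $A\in X$ has $A\in Y$) or (at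 least one of $X,Y$ is not in $\mathcal V$ and every $A\in\mathcal V$ with $A\in_1 X$ has $A\in_1 Y$). $|X|$ denotes classical cardinality of a Zermelo set, $P^n$ the $n$-fold iterate of $P$ ($P^0(X)=X$), $\mathbb N$ the Zermelo set of natural numbers. A Zermelo set $X$ is powered if $X=P(X')$ for some Zermelo set $X'$, otherwise non-powered. A Zermelo set $X$ has degree $k\ge1$ if $|P^{k-1}(\mathbb N)|<|X|\le|P^k(\mathbb N)|$, and degree $0$ if $|X|\le|\mathbb N|$. CH-cardinality: for a Zermelo set $U$, $|U|_{ch}=|U|$; for a non-Zermelo $U\in$ EZF, written $U=P^{-1}(X)$ with $X$ a non-powered Zermelo set of degree $k$, $|U|_{ch}=|P^{k-1}(\mathbb N)|$ if $k\ge1$ and $|U|_{ch}=|\mathbb N|$ if $k=0$. $\alpha$ is a CH-cardinal number iff $\alpha=|X|_{ch}$ for some $X\in$ EZF. For $A,B\in$ EZF, $A\preceq B$ iff there is $C\in$ EZF with $|C|_{ch}=|A|_{ch}$ and $C\subseteq B$. For CH-cardinals, $\alpha\le\alpha'$ iff there are $A,B\in$ EZF with $|A|_{ch}=\alpha$, $|B|_{ch}=\alpha'$ and $A\preceq B$; and $\alpha<\alpha'$ iff $\alpha\le\alpha'$ and not $\alpha'\le\alpha$. *)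

theory Defs
  imports Main
begin

text \<open>
  Formulas of the first-order language of ZF, with de Bruijn indices, used to state the axiom
  schemas of separation and replacement.  An assignment is a function from indices to objects.
\<close>

datatype fm =
    Member nat nat
  | Equal nat nat
  | Neg fm
  | Conj fm fm
  | All fm

text \<open>
  Structures for the language of EZF: \<open>'u\<close> is the domain of all objects, \<open>V\<close> the class of Zermelo
  sets, \<open>\<epsilon>\<close> membership and \<open>\<epsilon>\<^sub>1\<close> subset-membership.  No axioms are assumed in this locale.
\<close>

locale EZF_language =
  fixes V :: "'u set"
    and mem :: "'u \<Rightarrow> 'u \<Rightarrow> bool"  (infix "\<epsilon>" 50)
    and mem1 :: "'u \<Rightarrow> 'u \<Rightarrow> bool"  (infix "\<epsilon>\<^sub>1" 50)
begin

text \<open>Satisfaction with all quantifiers relativized to \<open>V\<close>; \<open>All\<close> binds index 0.\<close>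

primrec sat :: "(nat \<Rightarrow> 'u) \<Rightarrow> fm \<Rightarrow> bool" where
  "sat e (Member i j) \<longleftrightarrow> e i \<epsilon> e j"
| "sat e (Equal i j) \<longleftrightarrow> e i = e j"
| "sat e (Neg p) \<longleftrightarrow> \<not> sat e p"
| "sat e (Conj p q) \<longleftrightarrow> sat e p \<and> sat e q"
| "sat e (All p) \<longleftrightarrow> (\<forall>a\<in>V. sat (case_nat a e) p)"

definition is_empty :: "'u \<Rightarrow> bool" where
  "is_empty A \<longleftrightarrow> (\<forall>x\<in>V. \<not> x \<epsilon> A)"

definition is_upair :: "'u \<Rightarrow> 'u \<Rightarrow> 'u \<Rightarrow> bool" where
  "is_upair a b A \<longleftrightarrow> (\<forall>x\<in>V. x \<epsilon> A \<longleftrightarrow> x = a \<or> x = b)"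

definition is_succ :: "'u \<Rightarrow> 'u \<Rightarrow> bool" where
  "is_succ a A \<longleftrightarrow> (\<forall>x\<in>V. x \<epsilon> A \<longleftrightarrow> x \<epsilon> a \<or> x = a)"

definition is_inductive :: "'u \<Rightarrow> bool" where
  "is_inductive I \<longleftrightarrow> (\<exists>z\<in>V. is_empty z \<and> z \<epsilon> I) \<and>
     (\<forall>x\<in>V. x \<epsilon> I \<longrightarrow> (\<exists>s\<in>V. is_succ x s \<and> s \<epsilon> I))"

text \<open>\<open>is_power X Y\<close>: the object \<open>Y\<close> is \<open>P(X)\<close>; equivalently \<open>X\<close> is an inverse powerset of \<open>Y\<close>.\<close>

definition is_power :: "'u \<Rightarrow> 'u \<Rightarrow> bool" where
  "is_power X Y \<longleftrightarrow> (\<forall>A\<in>V. A \<epsilon>\<^sub>1 X \<longleftrightarrow> A \<epsilon> Y)"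

definition Vstar :: "'u set" where
  "Vstar = {Y \<in> V. \<not> is_empty Y}"

definition NN :: 'u where
  "NN = (THE N. N \<in> V \<and> (\<forall>x\<in>V. x \<epsilon> N \<longleftrightarrow> (\<forall>I\<in>V. is_inductive I \<longrightarrow> x \<epsilon> I)))"

definition P :: "'u \<Rightarrow> 'u" where
  "P X = (THE Y. Y \<in> V \<and> is_power X Y)"

text \<open>
  The axioms do not force an inverse powerset to be unique.  \<open>Pinv Y\<close> is the Zermelo set \<open>X\<close> with
  \<open>P(X) = Y\<close> if there is one, and otherwise some fixed object \<open>X\<close> with \<open>P(X) = Y\<close>.
  It is meaningful only for \<open>Y \<in> Vstar\<close>.
\<close>

definition Pinv :: "'u \<Rightarrow> 'u" where
  "Pinv Y = (SOME X. is_power X Y \<and> ((\<exists>Z\<in>V. is_power Z Y) \<longrightarrow> X \<in> V))"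

definition EZF_class :: "'u set" where
  "EZF_class = V \<union> Pinv ` Vstar"

definition ext_subset :: "'u \<Rightarrow> 'u \<Rightarrow> bool"  (infix "\<sqsubseteq>" 50) where
  "X \<sqsubseteq> Y \<longleftrightarrow>
     (X \<in> V \<and> Y \<in> V \<and> (\<forall>A\<in>V. A \<epsilon> X \<longrightarrow> A \<epsilon> Y)) \<or>
     ((X \<notin> V \<or> Y \<notin> V) \<and> (\<forall>A\<in>V. A \<epsilon>\<^sub>1 X \<longrightarrow> A \<epsilon>\<^sub>1 Y))"

text \<open>Functions between Zermelo sets are Zermelo sets of Kuratowski pairs.\<close>

definition is_opair :: "'u \<Rightarrow> 'u \<Rightarrow> 'u \<Rightarrow> bool" where
  "is_opair a b p \<longleftrightarrow> (\<exists>s\<in>V. \<exists>t\<in>V. is_upair a a s \<and> is_upair a b t \<and> is_upair s t p)"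

definition maps :: "'u \<Rightarrow> 'u \<Rightarrow> 'u \<Rightarrow> bool" where
  "maps f x y \<longleftrightarrow> (\<exists>p\<in>V. is_opair x y p \<and> p \<epsilon> f)"

definition is_function :: "'u \<Rightarrow> 'u \<Rightarrow> 'u \<Rightarrow> bool" where
  "is_function f X Y \<longleftrightarrow>
     (\<forall>p\<in>V. p \<epsilon> f \<longrightarrow> (\<exists>x\<in>V. \<exists>y\<in>V. x \<epsilon> X \<and> y \<epsilon> Y \<and> is_opair x y p)) \<and>
     (\<forall>x\<in>V. x \<epsilon> X \<longrightarrow> (\<exists>!y. y \<in> V \<and> maps f x y))"

definition is_injection :: "'u \<Rightarrow> 'u \<Rightarrow> 'u \<Rightarrow> bool" where
  "is_injection f X Y \<longleftrightarrow> is_function f X Y \<and>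
     (\<forall>x\<in>V. \<forall>x'\<in>V. \<forall>y\<in>V. maps f x y \<and> maps f x' y \<longrightarrow> x = x')"

definition is_bijection :: "'u \<Rightarrow> 'u \<Rightarrow> 'u \<Rightarrow> bool" where
  "is_bijection f X Y \<longleftrightarrow> is_injection f X Y \<and>
     (\<forall>y\<in>V. y \<epsilon> Y \<longrightarrow> (\<exists>x\<in>V. maps f x y))"

definition equipotent :: "'u \<Rightarrow> 'u \<Rightarrow> bool" where
  "equipotent X Y \<longleftrightarrow> (\<exists>f\<in>V. is_bijection f X Y)"

text \<open>The comparisons \<open>|X| \<le> |Y|\<close> and \<open>|X| < |Y|\<close> of classical cardinalities.\<close>

definition card_le :: "'u \<Rightarrow> 'u \<Rightarrow> bool" where
  "card_le X Y \<longleftrightarrow> (\<exists>f\<in>V. is_injection f X Y)"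

definition card_less :: "'u \<Rightarrow> 'u \<Rightarrow> bool" where
  "card_less X Y \<longleftrightarrow> card_le X Y \<and> \<not> equipotent X Y"

text \<open>The classical cardinality \<open>|X|\<close> of a Zermelo set is its equipotence class.\<close>

definition cardinality :: "'u \<Rightarrow> 'u set" where
  "cardinality X = {Y \<in> V. equipotent X Y}"

definition powered :: "'u \<Rightarrow> bool" where
  "powered X \<longleftrightarrow> (\<exists>X'\<in>V. X = P X')"

fun has_degree :: "'u \<Rightarrow> nat \<Rightarrow> bool" where
  "has_degree X 0 \<longleftrightarrow> card_le X NN"
| "has_degree X (Suc j) \<longleftrightarrow> card_less ((P ^^ j) NN) X \<and> card_le X ((P ^^ Suc j) NN)"

text \<open>
  \<open>has_ch_card U \<alpha>\<close> says that \<open>|U|\<^sub>c\<^sub>h\<close> is defined and equals \<open>\<alpha>\<close>.  It is a relation because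
  \<open>|P\<inverse>(X)|\<^sub>c\<^sub>h\<close> is left undefined when the non-powered set \<open>X\<close> has no finite degree.
\<close>

definition has_ch_card :: "'u \<Rightarrow> 'u set \<Rightarrow> bool" where
  "has_ch_card U \<alpha> \<longleftrightarrow>
     (U \<in> V \<and> \<alpha> = cardinality U) \<or>
     (U \<in> EZF_class \<and> U \<notin> V \<and>
       (\<exists>X\<in>Vstar. U = Pinv X \<and> \<not> powered X \<and>
         (\<exists>k. has_degree X k \<and>
            \<alpha> = (if k \<ge> 1 then cardinality ((P ^^ (k - 1)) NN) else cardinality NN))))"

text \<open>The value \<open>|U|\<^sub>c\<^sub>h\<close>, meaningful only where it is defined.\<close>

definition ch_card :: "'u \<Rightarrow> 'u set" where
  "ch_card U = (THE \<alpha>. has_ch_card U \<alpha>)"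

definition aleph0 :: "'u set" where
  "aleph0 = ch_card NN"

definition continuum :: "'u set" where
  "continuum = ch_card (P NN)"

definition ch_cardinal_number :: "'u set \<Rightarrow> bool" where
  "ch_cardinal_number \<alpha> \<longleftrightarrow> (\<exists>X\<in>EZF_class. has_ch_card X \<alpha>)"

definition ch_preceq :: "'u \<Rightarrow> 'u \<Rightarrow> bool" where
  "ch_preceq A B \<longleftrightarrow>
     (\<exists>C\<in>EZF_class. (\<exists>\<alpha>. has_ch_card C \<alpha> \<and> has_ch_card A \<alpha>) \<and> C \<sqsubseteq> B)"

definition ch_le :: "'u set \<Rightarrow> 'u set \<Rightarrow> bool" where
  "ch_le \<alpha> \<alpha>' \<longleftrightarrow>
     (\<exists>A\<in>EZF_class. \<exists>B\<in>EZF_class. has_ch_card A \<alpha> \<and> has_ch_card B \<alpha>' \<and> ch_preceq A B)"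

definition ch_less :: "'u set \<Rightarrow> 'u set \<Rightarrow> bool" where
  "ch_less \<alpha> \<alpha>' \<longleftrightarrow> ch_le \<alpha> \<alpha>' \<and> \<not> ch_le \<alpha>' \<alpha>"

end

text \<open>
  The theory EZF.  Transitivity expresses that \<open>V\<close> is the von Neumann universe, i.e.\ that the
  elements of Zermelo sets are Zermelo sets.  The schemas range over first-order formulas with
  parameters from \<open>V\<close>; since \<open>\<epsilon>\<^sub>1\<close> is definable from \<open>\<epsilon>\<close> on \<open>V\<close> by subset assignment,
  admitting \<open>\<epsilon>\<^sub>1\<close> in these formulas would not change them.
\<close>

locale EZF = EZF_language V mem mem1
  for V :: "'u set"
    and mem :: "'u \<Rightarrow> 'u \<Rightarrow> bool"  (infix "\<epsilon>" 50)
    and mem1 :: "'u \<Rightarrow> 'u \<Rightarrow> bool"  (infix "\<epsilon>\<^sub>1" 50) +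
  assumes transitivity: "\<And>A x. A \<in> V \<Longrightarrow> x \<epsilon> A \<Longrightarrow> x \<in> V"
    and null_set: "\<exists>A\<in>V. is_empty A"
    and foundation: "\<forall>A\<in>V. (\<exists>x\<in>V. x \<epsilon> A) \<longrightarrow> (\<exists>x\<in>V. x \<epsilon> A \<and> \<not> (\<exists>y\<in>V. y \<epsilon> x \<and> y \<epsilon> A))"
    and pairing: "\<forall>a\<in>V. \<forall>b\<in>V. \<exists>A\<in>V. is_upair a b A"
    and union: "\<forall>A\<in>V. \<exists>B\<in>V. \<forall>x\<in>V. x \<epsilon> B \<longleftrightarrow> (\<exists>y\<in>V. x \<epsilon> y \<and> y \<epsilon> A)"
    and infinity: "\<exists>I\<in>V. is_inductive I"
    and separation: "\<And>(p::fm) (e::nat \<Rightarrow> 'u). range e \<subseteq> V \<Longrightarrow>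
          \<forall>A\<in>V. \<exists>B\<in>V. \<forall>x\<in>V. x \<epsilon> B \<longleftrightarrow> x \<epsilon> A \<and> sat (case_nat x e) p"
    and replacement: "\<And>(p::fm) (e::nat \<Rightarrow> 'u). range e \<subseteq> V \<Longrightarrow>
          \<forall>A\<in>V. (\<forall>x\<in>V. x \<epsilon> A \<longrightarrow> (\<exists>!y. y \<in> V \<and> sat (case_nat y (case_nat x e)) p)) \<longrightarrow>
            (\<exists>B\<in>V. \<forall>y\<in>V. y \<epsilon> B \<longleftrightarrow> (\<exists>x\<in>V. x \<epsilon> A \<and> sat (case_nat y (case_nat x e)) p))"
    and extensionality: "\<forall>A\<in>V. \<forall>B\<in>V. (\<forall>S\<in>V. S \<epsilon>\<^sub>1 A \<longleftrightarrow> S \<epsilon>\<^sub>1 B) \<longrightarrow> A = B"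
    and powerset: "\<forall>X. \<exists>Y\<in>V. \<forall>A\<in>V. A \<epsilon>\<^sub>1 X \<longleftrightarrow> A \<epsilon> Y"
    and inverse_powerset: "\<forall>Y\<in>Vstar. \<exists>X. \<forall>A\<in>V. A \<epsilon> Y \<longleftrightarrow> A \<epsilon>\<^sub>1 X"
    and subset_assignment: "\<forall>X\<in>V. \<forall>A\<in>V. (\<forall>x. x \<epsilon> A \<longrightarrow> x \<epsilon> X) \<longleftrightarrow> A \<epsilon>\<^sub>1 X"

text \<open>
  EZF with choice for Zermelo sets: every Zermelo family of non-empty, pairwise disjoint sets has
  a transversal.
\<close>

locale EZFC = EZF V mem mem1
  for V :: "'u set"
    and mem :: "'u \<Rightarrow> 'u \<Rightarrow> bool"  (infix "\<epsilon>" 50)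
    and mem1 :: "'u \<Rightarrow> 'u \<Rightarrow> bool"  (infix "\<epsilon>\<^sub>1" 50) +
  assumes choice: "\<forall>F\<in>V.
      (\<forall>A\<in>V. A \<epsilon> F \<longrightarrow> (\<exists>x\<in>V. x \<epsilon> A)) \<and>
      (\<forall>A\<in>V. \<forall>B\<in>V. A \<epsilon> F \<and> B \<epsilon> F \<and> A \<noteq> B \<longrightarrow> \<not> (\<exists>x\<in>V. x \<epsilon> A \<and> x \<epsilon> B)) \<longrightarrow>
      (\<exists>C\<in>V. \<forall>A\<in>V. A \<epsilon> F \<longrightarrow> (\<exists>!x. x \<in> V \<and> x \<epsilon> A \<and> x \<epsilon> C))"

end

theory Submission
  imports Defs
begin

text \<open>
  Every CH-cardinal is the cardinality of some Zermelo set \<open>Y\<close>.  If neither \<open>|Y| \<le> |\<nat>|\<close> nor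
  \<open>|P(\<nat>)| \<le> |Y|\<close>, then comparability of cardinals places \<open>|Y|\<close> strictly between the two, and two
  cases remain.  If \<open>|P(Y)| \<le> |P(\<nat>)|\<close>, then \<open>X = P(Y) \<union> {{Y}}\<close> is non-powered of degree 1, so
  \<open>Y \<subseteq> P\<inverse>(X)\<close> with \<open>|P\<inverse>(X)|\<^sub>c\<^sub>h = |\<nat>|\<close>.  Otherwise \<open>Z = P(Y) - {\<emptyset>}\<close> is non-powered of
  degree 2, so \<open>P\<inverse>(Z) \<subseteq> Y\<close> with \<open>|P\<inverse>(Z)|\<^sub>c\<^sub>h = |P(\<nat>)|\<close>.  In either case \<open>|Y|\<close> is not strictly
  between \<open>\<aleph>\<^sub>0\<close> and the continuum in the order of CH-cardinals.
\<close>

section \<open>Definable predicates\<close>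

text \<open>Extended inclusion sees \<open>Pinv X\<close> only through its subset-members, which are
  the elements of \<open>X\<close>: \<open>A\<close> is included in \<open>Pinv X\<close> as soon as
  P(A) is a subset of \<open>X\<close>, and dually. Its CH-cardinality depends only on the degree of
  \<open>X\<close>, which is coarse: every non-powered \<open>X\<close> with |N| < |X| \<le> |P(N)|
  yields |N|. The natural choice X = P(Y) fails, since its inverse powerset is the Zermelo set
  \<open>Y\<close> again. Changing one element is enough to escape: foundation keeps P(Y) with
  \<open>{Y}\<close> added from being a powerset, and no powerset omits the empty set. One element
  must not shift the degree either, and the case split says which change leaves a degree that can be
  computed without knowing the size of P(Y).

  The technical obstacle is that separation is a schema over first-order formulas. Every set and map
  needs a formula, so maps are given by definable relations, and comparability, where choice enters,
  is derived from towers of sets rather than from ordinals.\<close>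

context EZF_language
begin

text \<open>
  Predicates take an environment rather than arguments so that closure under quantifiers is a
  syntax-directed rule; parameters of separation instances are ordinary entries of the environment.
\<close>

definition definable :: "((nat \<Rightarrow> 'u) \<Rightarrow> bool) \<Rightarrow> bool" where
  "definable Q \<longleftrightarrow> (\<exists>p. \<forall>e. range e \<subseteq> V \<longrightarrow> (Q e \<longleftrightarrow> sat e p))"

named_theorems definable_intros

lemma definable_mem [definable_intros]: "definable (\<lambda>e. e i \<epsilon> e j)"
  unfolding definable_def by (rule exI[of _ "Member i j"]) simp

lemma definable_eq [definable_intros]: "definable (\<lambda>e. e i = e j)"
  unfolding definable_def by (rule exI[of _ "Equal i j"]) simp

lemma definable_not [definable_intros]:
  assumes "definable Q" shows "definable (\<lambda>e. \<not> Q e)"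
proof -
  from assms obtain p where "\<forall>e. range e \<subseteq> V \<longrightarrow> (Q e \<longleftrightarrow> sat e p)"
    unfolding definable_def by blast
  then show ?thesis unfolding definable_def by (intro exI[of _ "Neg p"]) simp
qed

lemma definable_conj [definable_intros]:
  assumes "definable Q" "definable R" shows "definable (\<lambda>e. Q e \<and> R e)"
proof -
  from assms obtain p q where "\<forall>e. range e \<subseteq> V \<longrightarrow> (Q e \<longleftrightarrow> sat e p)"
    "\<forall>e. range e \<subseteq> V \<longrightarrow> (R e \<longleftrightarrow> sat e q)"
    unfolding definable_def by blast
  then show ?thesis unfolding definable_def by (intro exI[of _ "Conj p q"]) simp
qed

lemma definable_disj [definable_intros]:
  assumes "definable Q" "definable R" shows "definable (\<lambda>e. Q e \<or> R e)"
  using definable_not[OF definable_conj[OF definable_not[OF assms(1)] definable_not[OF assms(2)]]]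
  by simp

lemma definable_imp [definable_intros]:
  assumes "definable Q" "definable R" shows "definable (\<lambda>e. Q e \<longrightarrow> R e)"
  using definable_disj[OF definable_not[OF assms(1)] assms(2)] by (simp only: imp_conv_disj)

lemma definable_iff [definable_intros]:
  assumes "definable Q" "definable R" shows "definable (\<lambda>e. Q e \<longleftrightarrow> R e)"
  using definable_conj[OF definable_imp[OF assms] definable_imp[OF assms(2,1)]]
  by (simp only: iff_conv_conj_imp)

lemma range_case_nat: "a \<in> V \<Longrightarrow> range e \<subseteq> V \<Longrightarrow> range (case_nat a e) \<subseteq> V"
  unfolding image_subset_iff by (simp split: nat.splits)

lemma definable_True [definable_intros]: "definable (\<lambda>e. True)"
  using definable_eq[of 0 0] by simp

text \<open>\<open>\<phi>\<close> takes the bound value and the outer environment as separate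
  arguments; under the binder the value is entry 0 and the environment is shifted by one, exactly as
  in \<open>case_nat\<close>.\<close>

lemma definable_all [definable_intros]:
  assumes "definable (\<lambda>e. \<phi> (e 0) (\<lambda>i. e (Suc i)))"
  shows "definable (\<lambda>e. \<forall>a\<in>V. \<phi> a e)"
proof -
  from assms obtain p where p: "\<And>e. range e \<subseteq> V \<Longrightarrow> \<phi> (e 0) (\<lambda>i. e (Suc i)) \<longleftrightarrow> sat e p"
    unfolding definable_def by blast
  have "(\<forall>a\<in>V. \<phi> a e) \<longleftrightarrow> sat e (All p)" if "range e \<subseteq> V" for e
  proof -
    have "\<phi> a e \<longleftrightarrow> sat (case_nat a e) p" if "a \<in> V" for a
      using p[OF range_case_nat[OF that \<open>range e \<subseteq> V\<close>]] by simp
    then show ?thesis by simp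
  qed
  then show ?thesis unfolding definable_def by blast
qed

lemma definable_ex [definable_intros]:
  assumes "definable (\<lambda>e. \<phi> (e 0) (\<lambda>i. e (Suc i)))"
  shows "definable (\<lambda>e. \<exists>a\<in>V. \<phi> a e)"
  using definable_not[OF definable_all[OF definable_not[OF assms]]] by simp

lemma definable_is_empty [definable_intros]: "definable (\<lambda>e. is_empty (e i))"
  unfolding is_empty_def by (intro definable_intros)

lemma definable_is_upair [definable_intros]: "definable (\<lambda>e. is_upair (e i) (e j) (e k))"
  unfolding is_upair_def by (intro definable_intros)

lemma definable_is_succ [definable_intros]: "definable (\<lambda>e. is_succ (e i) (e j))"
  unfolding is_succ_def by (intro definable_intros)

lemma definable_is_inductive [definable_intros]: "definable (\<lambda>e. is_inductive (e i))"
  unfolding is_inductive_def by (intro definable_intros)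

lemma definable_is_opair [definable_intros]: "definable (\<lambda>e. is_opair (e i) (e j) (e k))"
  unfolding is_opair_def by (intro definable_intros)

lemma definable_maps [definable_intros]: "definable (\<lambda>e. maps (e i) (e j) (e k))"
  unfolding maps_def by (intro definable_intros)

text \<open>Stands in for \<open>\<epsilon>\<^sub>1\<close> between Zermelo sets, because
  \<open>fm\<close> has no atom for subset-membership.\<close>

definition subs :: "'u \<Rightarrow> 'u \<Rightarrow> bool" where
  "subs A B \<longleftrightarrow> (\<forall>x\<in>V. x \<epsilon> A \<longrightarrow> x \<epsilon> B)"

lemma definable_subs [definable_intros]: "definable (\<lambda>e. subs (e i) (e j))"
  unfolding subs_def by (intro definable_intros)

definition upair :: "'u \<Rightarrow> 'u \<Rightarrow> 'u" where
  "upair a b = (THE A. A \<in> V \<and> is_upair a b A)"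

definition opair :: "'u \<Rightarrow> 'u \<Rightarrow> 'u" where
  "opair a b = upair (upair a a) (upair a b)"

end

section \<open>Sets, pairs and cardinalities inside the universe\<close>

context EZF
begin

text \<open>The separated element and five parameters occupy entries 0 to 5. Asking for definability
  at arbitrary indices makes the goal match \<open>definable_intros\<close> syntactically.\<close>

lemma separation_definable:
  assumes "\<And>i j k l m n. definable (\<lambda>e. \<phi> (e i) (e j) (e k) (e l) (e m) (e n))"
    and "A \<in> V" "a \<in> V" "b \<in> V" "c \<in> V" "d \<in> V" "r \<in> V"
  shows "\<exists>B\<in>V. \<forall>x\<in>V. x \<epsilon> B \<longleftrightarrow> x \<epsilon> A \<and> \<phi> x a b c d r"
proof -
  \<comment> \<open>The constant tail supplies the fifth parameter and keeps all remaining entries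
    in \<open>V\<close>.\<close>
  define e where "e = case_nat a (case_nat b (case_nat c (case_nat d (\<lambda>_. r))))"
  have e: "range e \<subseteq> V" using assms(2-) by (auto simp: e_def split: nat.splits)
  from assms(1)[of 0 1 2 3 4 5] obtain p
    where p: "\<And>e. range e \<subseteq> V \<Longrightarrow> \<phi> (e 0) (e 1) (e 2) (e 3) (e 4) (e 5) \<longleftrightarrow> sat e p"
    unfolding definable_def by blast
  have "sat (case_nat x e) p \<longleftrightarrow> \<phi> x a b c d r" if "x \<in> V" for x
  proof -
    from p[OF range_case_nat[OF that e]] show ?thesis by (simp add: e_def eval_nat_numeral)
  qed
  with separation[OF e, of p] assms(2) show ?thesis by fastforce
qed

text \<open>The extensionality axiom compares subset-members. By subset assignment these are the
  subsets, and by transitivity of \<open>V\<close> sets with the same elements have the same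
  subsets.\<close>

lemma set_eqI:
  assumes "A \<in> V" "B \<in> V" "\<And>x. x \<in> V \<Longrightarrow> x \<epsilon> A \<longleftrightarrow> x \<epsilon> B"
  shows "A = B"
proof -
  have "S \<epsilon>\<^sub>1 A \<longleftrightarrow> S \<epsilon>\<^sub>1 B" if "S \<in> V" for S
    using assms subset_assignment that by (metis transitivity)
  with extensionality assms show ?thesis by blast
qed

lemma mem1_iff_subs: "X \<in> V \<Longrightarrow> A \<in> V \<Longrightarrow> A \<epsilon>\<^sub>1 X \<longleftrightarrow> subs A X"
  using subset_assignment transitivity unfolding subs_def by metis

text \<open>The powerset axiom covers non-Zermelo \<open>X\<close> as well; \<open>set_eqI\<close>
  makes the description unique.\<close>

lemma P_in_V_is_power: "P X \<in> V \<and> is_power X (P X)"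
proof -
  obtain Y where Y: "Y \<in> V" "is_power X Y" using powerset unfolding is_power_def by blast
  show ?thesis unfolding P_def
    by (rule theI[where a = Y]) (use Y in \<open>auto simp: is_power_def intro: set_eqI\<close>)
qed

lemma P_in_V [simp, intro]: "P X \<in> V"
  using P_in_V_is_power by blast

lemma P_iterate_in_V: "X \<in> V \<Longrightarrow> (P ^^ k) X \<in> V"
  by (cases k) auto

lemma P_eqI: "Y \<in> V \<Longrightarrow> is_power X Y \<Longrightarrow> P X = Y"
  using P_in_V_is_power[of X] by (auto simp: is_power_def intro: set_eqI)

lemma mem_P_iff: "X \<in> V \<Longrightarrow> A \<in> V \<Longrightarrow> A \<epsilon> P X \<longleftrightarrow> subs A X"
  using P_in_V_is_power[of X] mem1_iff_subs unfolding is_power_def by blast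

section \<open>Unordered pairs and Kuratowski pairs\<close>

lemma upair:
  assumes "a \<in> V" "b \<in> V"
  shows upair_in_V: "upair a b \<in> V" and is_upair_upair: "is_upair a b (upair a b)"
proof -
  obtain Y where Y: "Y \<in> V" "is_upair a b Y" using pairing assms by blast
  have "upair a b \<in> V \<and> is_upair a b (upair a b)" unfolding upair_def
    by (rule theI[where a = Y]) (use Y in \<open>auto simp: is_upair_def intro: set_eqI\<close>)
  then show "upair a b \<in> V" "is_upair a b (upair a b)" by auto
qed

lemma is_upair_iff: "a \<in> V \<Longrightarrow> b \<in> V \<Longrightarrow> A \<in> V \<Longrightarrow> is_upair a b A \<longleftrightarrow> A = upair a b"
  using upair[of a b] by (auto simp: is_upair_def intro: set_eqI)

lemma mem_upair_iff: "a \<in> V \<Longrightarrow> b \<in> V \<Longrightarrow> x \<epsilon> upair a b \<longleftrightarrow> x = a \<or> x = b"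
  using upair[of a b] transitivity unfolding is_upair_def by metis

lemma upair_eq_iff:
  assumes "a \<in> V" "b \<in> V" "c \<in> V" "d \<in> V"
  shows "upair a b = upair c d \<longleftrightarrow> a = c \<and> b = d \<or> a = d \<and> b = c"
proof
  assume "upair a b = upair c d"
  then have "x = a \<or> x = b \<longleftrightarrow> x = c \<or> x = d" for x
    using assms mem_upair_iff by metis
  then show "a = c \<and> b = d \<or> a = d \<and> b = c" by metis
next
  have "upair a b = upair b a"
    using assms by (intro set_eqI) (auto simp: mem_upair_iff upair_in_V)
  then show "a = c \<and> b = d \<or> a = d \<and> b = c \<Longrightarrow> upair a b = upair c d" by auto
qed

lemma opair_in_V [simp]: "a \<in> V \<Longrightarrow> b \<in> V \<Longrightarrow> opair a b \<in> V"
  by (simp add: opair_def upair_in_V)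

lemma opair_eq_iff:
  assumes "a \<in> V" "b \<in> V" "c \<in> V" "d \<in> V"
  shows "opair a b = opair c d \<longleftrightarrow> a = c \<and> b = d"
  using assms by (auto simp: opair_def upair_eq_iff upair_in_V)

lemma is_opair_iff:
  assumes "a \<in> V" "b \<in> V" "p \<in> V" shows "is_opair a b p \<longleftrightarrow> p = opair a b"
  using assms by (auto simp: is_opair_def opair_def is_upair_iff upair_in_V)

lemma maps_iff: "x \<in> V \<Longrightarrow> y \<in> V \<Longrightarrow> maps f x y \<longleftrightarrow> opair x y \<epsilon> f"
  using opair_in_V[of x y] unfolding maps_def by (auto simp: is_opair_iff)

section \<open>Relations and injections given by formulas\<close>

lemma union2_exists:
  assumes "A \<in> V" "B \<in> V" shows "\<exists>C\<in>V. \<forall>x\<in>V. x \<epsilon> C \<longleftrightarrow> x \<epsilon> A \<or> x \<epsilon> B"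
proof -
  have "upair A B \<in> V" using assms by (rule upair_in_V)
  with union obtain C where C: "C \<in> V" "\<forall>x\<in>V. x \<epsilon> C \<longleftrightarrow> (\<exists>y\<in>V. x \<epsilon> y \<and> y \<epsilon> upair A B)" by blast
  then show ?thesis using assms by (intro bexI[of _ C]) (auto simp: mem_upair_iff)
qed

text \<open>A Kuratowski pair with components in \<open>X\<close> and \<open>Y\<close> is a set of
  subsets of their union \<open>U\<close>, hence an element of \<open>P (P U)\<close>, from which
  separation cuts out the graph.\<close>

lemma relation_exists:
  assumes def: "\<And>i j k l m. definable (\<lambda>e. \<phi> (e i) (e j) (e k) (e l) (e m))"
    and V: "X \<in> V" "Y \<in> V" "a \<in> V" "b \<in> V" "c \<in> V"
  obtains f where "f \<in> V"
    "\<And>p. p \<epsilon> f \<longleftrightarrow> (\<exists>x y. x \<epsilon> X \<and> y \<epsilon> Y \<and> p = opair x y \<and> \<phi> x y a b c)"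
    "\<And>x y. x \<in> V \<Longrightarrow> y \<in> V \<Longrightarrow> maps f x y \<longleftrightarrow> x \<epsilon> X \<and> y \<epsilon> Y \<and> \<phi> x y a b c"
proof -
  obtain U where U: "U \<in> V" "\<forall>x\<in>V. x \<epsilon> U \<longleftrightarrow> x \<epsilon> X \<or> x \<epsilon> Y"
    using union2_exists V by blast
  have "\<exists>f\<in>V. \<forall>p\<in>V. p \<epsilon> f \<longleftrightarrow> p \<epsilon> P (P U) \<and>
     (\<exists>x\<in>V. \<exists>y\<in>V. is_opair x y p \<and> x \<epsilon> X \<and> y \<epsilon> Y \<and> \<phi> x y a b c)"
    by (rule separation_definable[of "\<lambda>p X Y a b c.
       \<exists>x\<in>V. \<exists>y\<in>V. is_opair x y p \<and> x \<epsilon> X \<and> y \<epsilon> Y \<and> \<phi> x y a b c"])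
       (use V in \<open>auto intro!: definable_intros def\<close>)
  then obtain f where f: "f \<in> V" "\<And>p. p \<in> V \<Longrightarrow> p \<epsilon> f \<longleftrightarrow> p \<epsilon> P (P U) \<and>
     (\<exists>x\<in>V. \<exists>y\<in>V. is_opair x y p \<and> x \<epsilon> X \<and> y \<epsilon> Y \<and> \<phi> x y a b c)" by blast
  have sub: "opair x y \<epsilon> P (P U)" if "x \<epsilon> X" "y \<epsilon> Y" for x y
    using that V U transitivity[of X x] transitivity[of Y y]
    by (auto simp: mem_P_iff subs_def opair_def mem_upair_iff upair_in_V)
  have "p \<epsilon> f \<longleftrightarrow> (\<exists>x y. x \<epsilon> X \<and> y \<epsilon> Y \<and> p = opair x y \<and> \<phi> x y a b c)" for p
  proof
    assume "p \<epsilon> f"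
    then have "p \<in> V" using f(1) transitivity by blast
    with \<open>p \<epsilon> f\<close> f(2) is_opair_iff show "\<exists>x y. x \<epsilon> X \<and> y \<epsilon> Y \<and> p = opair x y \<and> \<phi> x y a b c"
      by metis
  next
    assume "\<exists>x y. x \<epsilon> X \<and> y \<epsilon> Y \<and> p = opair x y \<and> \<phi> x y a b c"
    then obtain x y where xy: "x \<epsilon> X" "y \<epsilon> Y" "p = opair x y" "\<phi> x y a b c" by blast
    then have "x \<in> V" "y \<in> V" using V transitivity by blast+
    then show "p \<epsilon> f" using f(2)[of p] xy sub[of x y] by (auto simp: is_opair_iff)
  qed
  moreover from this have "maps f x y \<longleftrightarrow> x \<epsilon> X \<and> y \<epsilon> Y \<and> \<phi> x y a b c" if "x \<in> V" "y \<in> V" for x y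
    using that V transitivity by (auto simp: maps_iff opair_eq_iff)
  ultimately show thesis using that f(1) by blast
qed

text \<open>Lets maps be specified by formulas instead of sets of pairs. The description of
  \<open>maps\<close> is retained so that surjectivity can later be read off from the
  formula.\<close>

lemma injection_definable:
  assumes def: "\<And>i j k l m. definable (\<lambda>e. \<phi> (e i) (e j) (e k) (e l) (e m))"
    and V: "X \<in> V" "Y \<in> V" "a \<in> V" "b \<in> V" "c \<in> V"
    and ex: "\<And>x. x \<epsilon> X \<Longrightarrow> \<exists>y. y \<epsilon> Y \<and> \<phi> x y a b c"
    and fn: "\<And>x y y'. x \<epsilon> X \<Longrightarrow> y \<epsilon> Y \<Longrightarrow> y' \<epsilon> Y \<Longrightarrow> \<phi> x y a b c \<Longrightarrow> \<phi> x y' a b c \<Longrightarrow> y = y'"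
    and inj: "\<And>x x' y. x \<epsilon> X \<Longrightarrow> x' \<epsilon> X \<Longrightarrow> y \<epsilon> Y \<Longrightarrow> \<phi> x y a b c \<Longrightarrow> \<phi> x' y a b c \<Longrightarrow> x = x'"
  shows "\<exists>f\<in>V. is_injection f X Y \<and>
    (\<forall>x\<in>V. \<forall>y\<in>V. maps f x y \<longleftrightarrow> x \<epsilon> X \<and> y \<epsilon> Y \<and> \<phi> x y a b c)"
proof -
  obtain f where f: "f \<in> V"
    "\<And>p. p \<epsilon> f \<longleftrightarrow> (\<exists>x y. x \<epsilon> X \<and> y \<epsilon> Y \<and> p = opair x y \<and> \<phi> x y a b c)"
    "\<And>x y. x \<in> V \<Longrightarrow> y \<in> V \<Longrightarrow> maps f x y \<longleftrightarrow> x \<epsilon> X \<and> y \<epsilon> Y \<and> \<phi> x y a b c"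
    by (rule relation_exists[of \<phi> X Y a b c, OF def V]) (rule that)
  have "is_function f X Y" unfolding is_function_def
  proof (intro conjI ballI impI)
    fix p assume "p \<in> V" "p \<epsilon> f"
    then show "\<exists>x\<in>V. \<exists>y\<in>V. x \<epsilon> X \<and> y \<epsilon> Y \<and> is_opair x y p"
      using f(2)[of p] V transitivity is_opair_iff by metis
  next
    fix x assume x: "x \<in> V" "x \<epsilon> X"
    then obtain y where "y \<epsilon> Y" "\<phi> x y a b c" using ex by blast
    then show "\<exists>!y. y \<in> V \<and> maps f x y"
      using x f(3) fn V transitivity[of Y y] by (intro ex1I[of _ y]) auto
  qed
  moreover have "\<forall>x\<in>V. \<forall>x'\<in>V. \<forall>y\<in>V. maps f x y \<and> maps f x' y \<longrightarrow> x = x'"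
  proof (intro ballI impI)
    fix x x' y assume "x \<in> V" "x' \<in> V" "y \<in> V" "maps f x y \<and> maps f x' y"
    then show "x = x'" using inj[of x x' y] by (simp add: f(3))
  qed
  ultimately show ?thesis using f(1,3) unfolding is_injection_def by blast
qed

lemma injectionD:
  assumes "is_injection f X Y" "X \<in> V" "Y \<in> V" "f \<in> V"
  shows "x \<epsilon> X \<Longrightarrow> \<exists>y. y \<epsilon> Y \<and> maps f x y"
    and "x \<in> V \<Longrightarrow> y \<in> V \<Longrightarrow> maps f x y \<Longrightarrow> x \<epsilon> X \<and> y \<epsilon> Y"
    and "x \<epsilon> X \<Longrightarrow> y \<in> V \<Longrightarrow> y' \<in> V \<Longrightarrow> maps f x y \<Longrightarrow> maps f x y' \<Longrightarrow> y = y'"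
    and "x \<in> V \<Longrightarrow> x' \<in> V \<Longrightarrow> y \<in> V \<Longrightarrow> maps f x y \<Longrightarrow> maps f x' y \<Longrightarrow> x = x'"
proof -
  \<comment> \<open>\<open>maps\<close> only says that a pair lies in \<open>f\<close>; the first
    clause of \<open>is_function\<close> and injectivity of pairing locate its components.\<close>
  have dom: "x \<epsilon> X \<and> y \<epsilon> Y" if "x \<in> V" "y \<in> V" "maps f x y" for x y
  proof -
    from that have p: "opair x y \<in> V" "opair x y \<epsilon> f" by (auto simp: maps_iff)
    with assms(1) obtain x' y' where "x' \<in> V" "y' \<in> V" "x' \<epsilon> X" "y' \<epsilon> Y" "is_opair x' y' (opair x y)"
      unfolding is_injection_def is_function_def by blast
    with that p show ?thesis by (auto simp: is_opair_iff opair_eq_iff)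
  qed
  show "\<exists>y. y \<epsilon> Y \<and> maps f x y" if "x \<epsilon> X"
  proof -
    have "x \<in> V" using that assms transitivity by blast
    with assms(1) that obtain y where "y \<in> V" "maps f x y"
      unfolding is_injection_def is_function_def by blast
    with dom \<open>x \<in> V\<close> show ?thesis by blast
  qed
  show "x \<in> V \<Longrightarrow> y \<in> V \<Longrightarrow> maps f x y \<Longrightarrow> x \<epsilon> X \<and> y \<epsilon> Y" by (rule dom)
  show "x \<epsilon> X \<Longrightarrow> y \<in> V \<Longrightarrow> y' \<in> V \<Longrightarrow> maps f x y \<Longrightarrow> maps f x y' \<Longrightarrow> y = y'"
    using assms transitivity unfolding is_injection_def is_function_def by blast
  show "x \<in> V \<Longrightarrow> x' \<in> V \<Longrightarrow> y \<in> V \<Longrightarrow> maps f x y \<Longrightarrow> maps f x' y \<Longrightarrow> x = x'"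
    using assms unfolding is_injection_def by blast
qed

lemma card_le_definable:
  assumes "\<And>i j k l m. definable (\<lambda>e. \<phi> (e i) (e j) (e k) (e l) (e m))"
    and "X \<in> V" "Y \<in> V" "a \<in> V" "b \<in> V" "c \<in> V"
    and "\<And>x. x \<epsilon> X \<Longrightarrow> \<exists>y. y \<epsilon> Y \<and> \<phi> x y a b c"
    and "\<And>x y y'. x \<epsilon> X \<Longrightarrow> y \<epsilon> Y \<Longrightarrow> y' \<epsilon> Y \<Longrightarrow> \<phi> x y a b c \<Longrightarrow> \<phi> x y' a b c \<Longrightarrow> y = y'"
    and "\<And>x x' y. x \<epsilon> X \<Longrightarrow> x' \<epsilon> X \<Longrightarrow> y \<epsilon> Y \<Longrightarrow> \<phi> x y a b c \<Longrightarrow> \<phi> x' y a b c \<Longrightarrow> x = x'"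
  shows "card_le X Y"
proof -
  have "\<exists>f\<in>V. is_injection f X Y \<and>
    (\<forall>x\<in>V. \<forall>y\<in>V. maps f x y \<longleftrightarrow> x \<epsilon> X \<and> y \<epsilon> Y \<and> \<phi> x y a b c)"
    by (rule injection_definable[of \<phi> X Y a b c]) (fact assms)+
  then show ?thesis unfolding card_le_def by blast
qed

lemma equipotent_definable:
  assumes "\<And>i j k l m. definable (\<lambda>e. \<phi> (e i) (e j) (e k) (e l) (e m))"
    and "X \<in> V" "Y \<in> V" "a \<in> V" "b \<in> V" "c \<in> V"
    and "\<And>x. x \<epsilon> X \<Longrightarrow> \<exists>y. y \<epsilon> Y \<and> \<phi> x y a b c"
    and "\<And>x y y'. x \<epsilon> X \<Longrightarrow> y \<epsilon> Y \<Longrightarrow> y' \<epsilon> Y \<Longrightarrow> \<phi> x y a b c \<Longrightarrow> \<phi> x y' a b c \<Longrightarrow> y = y'"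
    and "\<And>x x' y. x \<epsilon> X \<Longrightarrow> x' \<epsilon> X \<Longrightarrow> y \<epsilon> Y \<Longrightarrow> \<phi> x y a b c \<Longrightarrow> \<phi> x' y a b c \<Longrightarrow> x = x'"
    and "\<And>y. y \<epsilon> Y \<Longrightarrow> \<exists>x. x \<epsilon> X \<and> \<phi> x y a b c"
  shows "equipotent X Y"
proof -
  have "\<exists>f\<in>V. is_injection f X Y \<and>
    (\<forall>x\<in>V. \<forall>y\<in>V. maps f x y \<longleftrightarrow> x \<epsilon> X \<and> y \<epsilon> Y \<and> \<phi> x y a b c)"
    by (rule injection_definable[of \<phi> X Y a b c]) (fact assms)+
  then obtain f where f: "f \<in> V" "is_injection f X Y"
    "\<And>x y. x \<in> V \<Longrightarrow> y \<in> V \<Longrightarrow> maps f x y \<longleftrightarrow> x \<epsilon> X \<and> y \<epsilon> Y \<and> \<phi> x y a b c" by blast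
  then have "\<exists>x\<in>V. maps f x y" if "y \<in> V" "y \<epsilon> Y" for y
    using that assms(2,10) transitivity by metis
  with f show ?thesis unfolding equipotent_def is_bijection_def by blast
qed

section \<open>Elementary comparison of classical cardinalities\<close>

lemma card_le_subs: "X \<in> V \<Longrightarrow> Y \<in> V \<Longrightarrow> subs X Y \<Longrightarrow> card_le X Y"
  by (rule card_le_definable[of "\<lambda>x y _ _ _. x = y" X Y X X X])
     (auto intro!: definable_intros simp: subs_def dest: transitivity)

lemma card_le_trans:
  assumes "card_le X Y" "card_le Y Z" and V: "X \<in> V" "Y \<in> V" "Z \<in> V"
  shows "card_le X Z"
proof -
  obtain f g where f: "f \<in> V" "is_injection f X Y" and g: "g \<in> V" "is_injection g Y Z"
    using assms unfolding card_le_def by blast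
  note f' = injectionD[OF f(2) V(1,2) f(1)] and g' = injectionD[OF g(2) V(2,3) g(1)]
  show ?thesis
  proof (rule card_le_definable[of "\<lambda>x z f g _. \<exists>y\<in>V. maps f x y \<and> maps g y z" X Z f g X])
    show "\<exists>z. z \<epsilon> Z \<and> (\<exists>y\<in>V. maps f x y \<and> maps g y z)" if "x \<epsilon> X" for x
      using that f'(1) g'(1) V transitivity by metis
    show "z = z'" if "x \<epsilon> X" "z \<epsilon> Z" "z' \<epsilon> Z"
      "\<exists>y\<in>V. maps f x y \<and> maps g y z" "\<exists>y\<in>V. maps f x y \<and> maps g y z'" for x z z'
      using that f'(2,3) g'(2,3) V transitivity by metis
    show "x = x'" if "x \<epsilon> X" "x' \<epsilon> X" "z \<epsilon> Z"
      "\<exists>y\<in>V. maps f x y \<and> maps g y z" "\<exists>y\<in>V. maps f x' y \<and> maps g y z" for x x' z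
      using that f'(4) g'(4) V transitivity by metis
  qed (use V f g in \<open>auto intro!: definable_intros\<close>)
qed

lemma equipotent_imp_card_le: "equipotent X Y \<Longrightarrow> card_le X Y"
  unfolding equipotent_def card_le_def is_bijection_def by blast

lemma equipotent_sym:
  assumes "equipotent X Y" and V: "X \<in> V" "Y \<in> V"
  shows "equipotent Y X"
proof -
  obtain f where f: "f \<in> V" "is_bijection f X Y" using assms unfolding equipotent_def by blast
  then have inj: "is_injection f X Y" unfolding is_bijection_def by blast
  note f' = injectionD[OF inj V f(1)]
  show ?thesis
  proof (rule equipotent_definable[of "\<lambda>y x f _ _. maps f x y" Y X f f f])
    show "\<exists>x. x \<epsilon> X \<and> maps f x y" if "y \<epsilon> Y" for y
      using f(2) f'(2) that V transitivity unfolding is_bijection_def by metis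
    show "\<exists>y. y \<epsilon> Y \<and> maps f x y" if "x \<epsilon> X" for x
      using f'(1) that by blast
    show "x = x'" if "y \<epsilon> Y" "x \<epsilon> X" "x' \<epsilon> X" "maps f x y" "maps f x' y" for x x' y
      using that f'(4) V transitivity by blast
    show "y = y'" if "y \<epsilon> Y" "y' \<epsilon> Y" "x \<epsilon> X" "maps f x y" "maps f x y'" for x y y'
      using that f'(3) V transitivity by blast
  qed (use V f in \<open>auto intro!: definable_intros\<close>)
qed

lemma equipotent_trans:
  assumes "equipotent X Y" "equipotent Y Z" and V: "X \<in> V" "Y \<in> V" "Z \<in> V"
  shows "equipotent X Z"
proof -
  obtain f g where f: "f \<in> V" "is_bijection f X Y" and g: "g \<in> V" "is_bijection g Y Z"
    using assms unfolding equipotent_def by blast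
  then have inj: "is_injection f X Y" "is_injection g Y Z" unfolding is_bijection_def by auto
  note f' = injectionD[OF inj(1) V(1,2) f(1)] and g' = injectionD[OF inj(2) V(2,3) g(1)]
  have surj: "\<exists>x. x \<epsilon> X \<and> maps f x y" if "y \<epsilon> Y" for y
    using f(2) f'(2) that V transitivity unfolding is_bijection_def by metis
  have surj': "\<exists>y. y \<epsilon> Y \<and> maps g y z" if "z \<epsilon> Z" for z
    using g(2) g'(2) that V transitivity unfolding is_bijection_def by metis
  show ?thesis
  proof (rule equipotent_definable[of "\<lambda>x z f g _. \<exists>y\<in>V. maps f x y \<and> maps g y z" X Z f g X])
    show "\<exists>z. z \<epsilon> Z \<and> (\<exists>y\<in>V. maps f x y \<and> maps g y z)" if "x \<epsilon> X" for x
      using that f'(1) g'(1) V transitivity by metis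
    show "\<exists>x. x \<epsilon> X \<and> (\<exists>y\<in>V. maps f x y \<and> maps g y z)" if "z \<epsilon> Z" for z
      using that surj surj' V transitivity by metis
    show "z = z'" if "x \<epsilon> X" "z \<epsilon> Z" "z' \<epsilon> Z"
      "\<exists>y\<in>V. maps f x y \<and> maps g y z" "\<exists>y\<in>V. maps f x y \<and> maps g y z'" for x z z'
      using that f'(2,3) g'(2,3) V transitivity by metis
    show "x = x'" if "x \<epsilon> X" "x' \<epsilon> X" "z \<epsilon> Z"
      "\<exists>y\<in>V. maps f x y \<and> maps g y z" "\<exists>y\<in>V. maps f x' y \<and> maps g y z" for x x' z
      using that f'(4) g'(4) V transitivity by metis
  qed (use V f g in \<open>auto intro!: definable_intros\<close>)
qed

lemma cardinality_eqI:
  assumes "equipotent X Y" "X \<in> V" "Y \<in> V"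
  shows "cardinality X = cardinality Y"
proof -
  have "equipotent X Z \<longleftrightarrow> equipotent Y Z" if "Z \<in> V" for Z
    using equipotent_trans[OF assms(1) _ assms(2,3) that]
      equipotent_trans[OF equipotent_sym[OF assms] _ assms(3,2) that] by blast
  then show ?thesis unfolding cardinality_def by blast
qed

text \<open>\<open>C\<close> is the range of the injection. This passes from injections, which
  define \<open>card_le\<close>, to inclusions, which define \<open>ch_preceq\<close>.\<close>

lemma equipotent_subset:
  assumes "card_le X Y" and V: "X \<in> V" "Y \<in> V"
  obtains C where "C \<in> V" "subs C Y" "equipotent X C"
proof -
  obtain f where f: "f \<in> V" "is_injection f X Y" using assms unfolding card_le_def by blast
  note f' = injectionD[OF f(2) V f(1)]
  have "\<exists>C\<in>V. \<forall>y\<in>V. y \<epsilon> C \<longleftrightarrow> y \<epsilon> Y \<and> (\<exists>x\<in>V. maps f x y)"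
    by (rule separation_definable[of "\<lambda>y f _ _ _ _. \<exists>x\<in>V. maps f x y"])
       (use V f in \<open>auto intro!: definable_intros\<close>)
  then obtain C where C: "C \<in> V" "\<And>y. y \<in> V \<Longrightarrow> y \<epsilon> C \<longleftrightarrow> y \<epsilon> Y \<and> (\<exists>x\<in>V. maps f x y)" by blast
  have "equipotent X C"
  proof (rule equipotent_definable[of "\<lambda>x y f _ _. maps f x y" X C f f f])
    show "\<exists>y. y \<epsilon> C \<and> maps f x y" if "x \<epsilon> X" for x
      using f'(1) that C V transitivity by metis
    show "\<exists>x. x \<epsilon> X \<and> maps f x y" if "y \<epsilon> C" for y
      using f'(2) that C V transitivity by metis
    show "y = y'" if "x \<epsilon> X" "y \<epsilon> C" "y' \<epsilon> C" "maps f x y" "maps f x y'" for x y y'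
      using that f'(3)[of x y y'] transitivity[OF C(1)] by blast
    show "x = x'" if "x \<epsilon> X" "x' \<epsilon> X" "y \<epsilon> C" "maps f x y" "maps f x' y" for x x' y
      using that f'(4)[of x x' y] transitivity[OF C(1)] transitivity[OF V(1)] by blast
  qed (use V f C in \<open>auto intro!: definable_intros\<close>)
  then show thesis using that C unfolding subs_def by blast
qed

text \<open>Each subset of \<open>X\<close> is sent to its image under the injection.\<close>

lemma card_le_P_mono:
  assumes "card_le X Y" and V: "X \<in> V" "Y \<in> V"
  shows "card_le (P X) (P Y)"
proof -
  obtain f where f: "f \<in> V" "is_injection f X Y" using assms unfolding card_le_def by blast
  note f' = injectionD[OF f(2) V f(1)]
  show ?thesis
  proof (rule card_le_definable[of "\<lambda>A B f _ _. \<forall>y\<in>V. y \<epsilon> B \<longleftrightarrow> (\<exists>x\<in>V. x \<epsilon> A \<and> maps f x y)"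
        "P X" "P Y" f f f])
    fix A assume A: "A \<epsilon> P X"
    then have AV: "A \<in> V" using P_in_V transitivity by blast
    have "\<exists>B\<in>V. \<forall>y\<in>V. y \<epsilon> B \<longleftrightarrow> y \<epsilon> Y \<and> (\<exists>x\<in>V. x \<epsilon> A \<and> maps f x y)"
      by (rule separation_definable[of "\<lambda>y A f _ _ _. \<exists>x\<in>V. x \<epsilon> A \<and> maps f x y"])
         (use V f AV in \<open>auto intro!: definable_intros\<close>)
    then obtain B where "B \<in> V" "\<forall>y\<in>V. y \<epsilon> B \<longleftrightarrow> y \<epsilon> Y \<and> (\<exists>x\<in>V. x \<epsilon> A \<and> maps f x y)" by blast
    then show "\<exists>B. B \<epsilon> P Y \<and> (\<forall>y\<in>V. y \<epsilon> B \<longleftrightarrow> (\<exists>x\<in>V. x \<epsilon> A \<and> maps f x y))"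
      using f'(2) V by (intro exI[of _ B]) (auto simp: mem_P_iff subs_def)
  next
    fix A B B' assume "A \<epsilon> P X" "B \<epsilon> P Y" "B' \<epsilon> P Y"
      "\<forall>y\<in>V. y \<epsilon> B \<longleftrightarrow> (\<exists>x\<in>V. x \<epsilon> A \<and> maps f x y)"
      "\<forall>y\<in>V. y \<epsilon> B' \<longleftrightarrow> (\<exists>x\<in>V. x \<epsilon> A \<and> maps f x y)"
    then show "B = B'" using P_in_V transitivity by (intro set_eqI) blast+
  next
    fix A A' B assume A: "A \<epsilon> P X" "A' \<epsilon> P X" "B \<epsilon> P Y"
      "\<forall>y\<in>V. y \<epsilon> B \<longleftrightarrow> (\<exists>x\<in>V. x \<epsilon> A \<and> maps f x y)"
      "\<forall>y\<in>V. y \<epsilon> B \<longleftrightarrow> (\<exists>x\<in>V. x \<epsilon> A' \<and> maps f x y)"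
    have AV: "A \<in> V" "A' \<in> V" using A P_in_V transitivity by blast+
    \<comment> \<open>Used in both directions: the value at \<open>x\<close> lies in the common
      image \<open>B\<close>, so it is also the value at some element of \<open>A2\<close>, which
      injectivity identifies with \<open>x\<close>.\<close>
    have *: "x \<epsilon> A2" if "x \<in> V" "x \<epsilon> A1" "subs A1 X"
      "\<forall>y\<in>V. y \<epsilon> B \<longleftrightarrow> (\<exists>x\<in>V. x \<epsilon> A1 \<and> maps f x y)"
      "\<forall>y\<in>V. y \<epsilon> B \<longleftrightarrow> (\<exists>x\<in>V. x \<epsilon> A2 \<and> maps f x y)" for x A1 A2
    proof -
      have "x \<epsilon> X" using that unfolding subs_def by blast
      then obtain y where y: "y \<in> V" "maps f x y" using f'(1) V transitivity by blast
      with that obtain x' where "x' \<in> V" "x' \<epsilon> A2" "maps f x' y" by blast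
      with f'(4) y that show ?thesis by blast
    qed
    have "subs A X" "subs A' X" using A AV V mem_P_iff by blast+
    then show "A = A'" using * A(4,5) AV by (intro set_eqI) blast+
  qed (use V f in \<open>auto intro!: definable_intros\<close>)
qed

lemma card_le_P: "X \<in> V \<Longrightarrow> card_le X (P X)"
proof (rule card_le_definable[of "\<lambda>x A _ _ _. is_upair x x A" X "P X" X X X])
  assume X: "X \<in> V"
  show "\<exists>A. A \<epsilon> P X \<and> is_upair x x A" if "x \<epsilon> X" for x
    using X transitivity[OF X that] upair_in_V[of x x] that
    by (intro exI[of _ "upair x x"]) (auto simp: mem_P_iff subs_def mem_upair_iff is_upair_iff)
  show "A = B" if "A \<epsilon> P X" "B \<epsilon> P X" "is_upair x x A" "is_upair x x B" for x A B
    using that transitivity[OF P_in_V] unfolding is_upair_def by (intro set_eqI) blast+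
  show "x = y" if "x \<epsilon> X" "y \<epsilon> X" "is_upair x x A" "is_upair y y A" for x y A
    using that transitivity[OF X] unfolding is_upair_def by blast
qed (auto intro!: definable_intros)

section \<open>Foundation and the natural numbers\<close>

lemma mem_irrefl: "A \<in> V \<Longrightarrow> \<not> A \<epsilon> A"
proof
  assume A: "A \<in> V" "A \<epsilon> A"
  with foundation upair_in_V[of A A] show False by (metis mem_upair_iff)
qed

text \<open>Foundation applied to the set with elements \<open>A\<close> and \<open>B\<close>; the
  absence of such cycles makes the successor injective.\<close>

lemma mem_asym: "A \<in> V \<Longrightarrow> B \<in> V \<Longrightarrow> A \<epsilon> B \<Longrightarrow> \<not> B \<epsilon> A"
proof
  assume A: "A \<in> V" "B \<in> V" "A \<epsilon> B" "B \<epsilon> A"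
  with foundation upair_in_V[of A B] show False by (metis mem_upair_iff)
qed

text \<open>The intersection of all inductive sets is separated from one inductive set
  \<open>J\<close>.\<close>

lemma NN: "NN \<in> V" "\<And>x. x \<in> V \<Longrightarrow> x \<epsilon> NN \<longleftrightarrow> (\<forall>I\<in>V. is_inductive I \<longrightarrow> x \<epsilon> I)"
proof -
  obtain J where J: "J \<in> V" "is_inductive J" using infinity by blast
  have "\<exists>N\<in>V. \<forall>x\<in>V. x \<epsilon> N \<longleftrightarrow> x \<epsilon> J \<and> (\<forall>I\<in>V. is_inductive I \<longrightarrow> x \<epsilon> I)"
    by (rule separation_definable[of "\<lambda>x _ _ _ _ _. \<forall>I\<in>V. is_inductive I \<longrightarrow> x \<epsilon> I"])
       (use J in \<open>auto intro!: definable_intros\<close>)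
  then obtain N where N: "N \<in> V" "\<forall>x\<in>V. x \<epsilon> N \<longleftrightarrow> (\<forall>I\<in>V. is_inductive I \<longrightarrow> x \<epsilon> I)"
    using J by blast
  have "NN \<in> V \<and> (\<forall>x\<in>V. x \<epsilon> NN \<longleftrightarrow> (\<forall>I\<in>V. is_inductive I \<longrightarrow> x \<epsilon> I))"
    unfolding NN_def by (rule theI[where a = N]) (use N in \<open>auto intro: set_eqI\<close>)
  then show "NN \<in> V" "\<And>x. x \<in> V \<Longrightarrow> x \<epsilon> NN \<longleftrightarrow> (\<forall>I\<in>V. is_inductive I \<longrightarrow> x \<epsilon> I)" by auto
qed

text \<open>\<open>is_inductive\<close> only provides some empty set and some successor; here and
  for successors, extensionality identifies it with the given one.\<close>

lemma empty_in_NN: "z \<in> V \<Longrightarrow> is_empty z \<Longrightarrow> z \<epsilon> NN"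
proof -
  assume z: "z \<in> V" "is_empty z"
  have "z = z'" if "z' \<in> V" "is_empty z'" for z'
    using that z unfolding is_empty_def by (intro set_eqI) auto
  then show ?thesis using z NN(2) unfolding is_inductive_def by blast
qed

lemma succ_in_NN:
  assumes "x \<epsilon> NN" "s \<in> V" "is_succ x s" shows "s \<epsilon> NN"
proof -
  have x: "x \<in> V" using assms NN(1) transitivity by blast
  have "s = s'" if "s' \<in> V" "is_succ x s'" for s'
    using that assms unfolding is_succ_def by (intro set_eqI) auto
  then show ?thesis using x assms NN(2) unfolding is_inductive_def by blast
qed

lemma succ_exists: "x \<epsilon> NN \<Longrightarrow> \<exists>s\<in>V. is_succ x s"
  using NN infinity transitivity[OF NN(1)] unfolding is_inductive_def by blast

text \<open>If the two were distinct, each would be an element of the other.\<close>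

lemma succ_inj:
  assumes "a \<in> V" "b \<in> V" "is_succ a s" "is_succ b s" shows "a = b"
  using assms mem_asym unfolding is_succ_def by blast

text \<open>
  Shifting the subsets of the natural numbers by the successor function leaves \<open>{\<emptyset>}\<close> outside the
  range, which makes room for one more element.
\<close>

lemma card_le_insert:
  assumes "card_le X (P NN)" and V: "X \<in> V" "z \<in> V" "W \<in> V"
    and W: "\<And>x. x \<epsilon> W \<Longrightarrow> x \<epsilon> X \<or> x = z"
  shows "card_le W (P NN)"
proof -
  obtain g where g: "g \<in> V" "is_injection g X (P NN)" using assms unfolding card_le_def by blast
  note g' = injectionD[OF g(2) V(1) P_in_V g(1)]
  obtain e where e: "e \<in> V" "is_empty e" using null_set by blast
  define u where "u = upair e e"
  have u: "u \<in> V" "\<And>x. x \<epsilon> u \<longleftrightarrow> x = e"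
    using e by (auto simp: u_def upair_in_V mem_upair_iff)
  define \<psi> where
    "\<psi> A B \<longleftrightarrow> (\<forall>n\<in>V. n \<epsilon> B \<longleftrightarrow> (\<exists>a\<in>V. a \<epsilon> A \<and> is_succ a n))" for A B
  have \<psi>_ex: "\<exists>B. B \<epsilon> P NN \<and> \<psi> A B" if A: "A \<epsilon> P NN" for A
  proof -
    have AV: "A \<in> V" using A transitivity by blast
    have "\<exists>B\<in>V. \<forall>n\<in>V. n \<epsilon> B \<longleftrightarrow> n \<epsilon> NN \<and> (\<exists>a\<in>V. a \<epsilon> A \<and> is_succ a n)"
      by (rule separation_definable[of "\<lambda>n A _ _ _ _. \<exists>a\<in>V. a \<epsilon> A \<and> is_succ a n"])
         (use AV NN(1) in \<open>auto intro!: definable_intros\<close>)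
    then obtain B where B: "B \<in> V"
      "\<And>n. n \<in> V \<Longrightarrow> n \<epsilon> B \<longleftrightarrow> n \<epsilon> NN \<and> (\<exists>a\<in>V. a \<epsilon> A \<and> is_succ a n)" by blast
    have "subs A NN" using A AV NN(1) mem_P_iff by blast
    then have "\<psi> A B" using B(2) succ_in_NN unfolding \<psi>_def subs_def by blast
    moreover have "B \<epsilon> P NN" using B NN(1) by (simp add: mem_P_iff subs_def)
    ultimately show ?thesis by blast
  qed
  have \<psi>_fun: "B = B'" if "\<psi> A B" "\<psi> A B'" "B \<epsilon> P NN" "B' \<epsilon> P NN" for A B B'
    using that transitivity[OF P_in_V] unfolding \<psi>_def by (intro set_eqI) blast+
  \<comment> \<open>One half of injectivity: an element of \<open>A\<close> is a natural number, so
    it has a successor; this lies in \<open>B\<close> and is therefore the successor of an element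
    of \<open>A'\<close>.\<close>
  have \<psi>_sub: "subs A A'" if A: "\<psi> A B" "\<psi> A' B" "A \<epsilon> P NN" for A A' B
    unfolding subs_def
  proof (intro ballI impI)
    fix a assume a: "a \<in> V" "a \<epsilon> A"
    have "subs A NN" using A(3) transitivity[OF P_in_V] NN(1) mem_P_iff by blast
    with a obtain s where s: "s \<in> V" "is_succ a s" using succ_exists unfolding subs_def by blast
    with A a obtain a' where "a' \<in> V" "a' \<epsilon> A'" "is_succ a' s" unfolding \<psi>_def by blast
    with succ_inj a s show "a \<epsilon> A'" by blast
  qed
  have \<psi>_inj: "A = A'" if "\<psi> A B" "\<psi> A' B" "A \<epsilon> P NN" "A' \<epsilon> P NN" for A A' B
    using \<psi>_sub[OF that(1,2,3)] \<psi>_sub[OF that(2,1,4)] transitivity[OF P_in_V] that(3,4)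
    unfolding subs_def by (intro set_eqI) blast+
  \<comment> \<open>The element \<open>e\<close> of \<open>u\<close> would have to be a successor,
    but successors are non-empty.\<close>
  have \<psi>_u: "\<not> \<psi> A u" for A
    using e u unfolding \<psi>_def is_succ_def is_empty_def by blast
  \<comment> \<open>The element \<open>z\<close> is sent to \<open>u\<close>, every other one to the
    shift of its value under \<open>g\<close>. Testing \<open>x = z\<close> first makes this correct
    even if \<open>z\<close> already lies in \<open>X\<close>.\<close>
  let ?\<phi> = "\<lambda>x B g z u. (x = z \<and> B = u) \<or> (x \<noteq> z \<and> (\<exists>A\<in>V. maps g x A \<and> \<psi> A B))"
  show ?thesis
  proof (rule card_le_definable[of ?\<phi> W "P NN" g z u])
    fix x assume x: "x \<epsilon> W"
    show "\<exists>B. B \<epsilon> P NN \<and> ?\<phi> x B g z u"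
    proof (cases "x = z")
      case True
      have "u \<epsilon> P NN"
        using u empty_in_NN[OF e] NN(1) by (auto simp: mem_P_iff subs_def)
      with True show ?thesis by blast
    next
      case False
      then obtain A where A: "A \<epsilon> P NN" "maps g x A" using g'(1) W x by blast
      then show ?thesis using \<psi>_ex[OF A(1)] False transitivity[OF P_in_V] by blast
    qed
  next
    fix x B B' assume "x \<epsilon> W" "B \<epsilon> P NN" "B' \<epsilon> P NN" "?\<phi> x B g z u" "?\<phi> x B' g z u"
    then show "B = B'" using \<psi>_fun g'(3) W by metis
  next
    fix x x' B assume B: "x \<epsilon> W" "x' \<epsilon> W" "B \<epsilon> P NN" "?\<phi> x B g z u" "?\<phi> x' B g z u"
    have xV: "x \<in> V" "x' \<in> V" using B V transitivity by blast+
    show "x = x'"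
    proof (cases "x = z \<or> x' = z")
      case True
      then show ?thesis using B(4,5) \<psi>_u by blast
    next
      case False
      with B obtain A A' where A: "A \<in> V" "A' \<in> V" "maps g x A" "maps g x' A'" "\<psi> A B" "\<psi> A' B"
        by blast
      moreover have "A \<epsilon> P NN" "A' \<epsilon> P NN" using g'(2) A xV by blast+
      ultimately have "A = A'" using \<psi>_inj by blast
      with A xV g'(4) show ?thesis by blast
    qed
  qed (use V g u in \<open>auto intro!: definable_intros simp: \<psi>_def\<close>)
qed

section \<open>CH-cardinalities\<close>

text \<open>If \<open>Pinv Y\<close> were a Zermelo set, \<open>Y\<close> would be its powerset and
  hence powered.\<close>

lemma Pinv_is_power: "Y \<in> Vstar \<Longrightarrow> is_power (Pinv Y) Y"
  and Pinv_notin_V: "Y \<in> Vstar \<Longrightarrow> \<not> powered Y \<Longrightarrow> Pinv Y \<notin> V"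
proof -
  show pow: "is_power (Pinv Y) Y" if "Y \<in> Vstar" for Y
  proof -
    from inverse_powerset that obtain X where "\<forall>A\<in>V. A \<epsilon> Y \<longleftrightarrow> A \<epsilon>\<^sub>1 X" by blast
    then have "is_power X Y" unfolding is_power_def by simp
    \<comment> \<open>A Zermelo inverse powerset is taken if there is one, and the given
      \<open>X\<close> otherwise.\<close>
    then have "\<exists>X. is_power X Y \<and> ((\<exists>Z\<in>V. is_power Z Y) \<longrightarrow> X \<in> V)" by blast
    from someI_ex[OF this] show ?thesis unfolding Pinv_def by blast
  qed
  show "Y \<in> Vstar \<Longrightarrow> \<not> powered Y \<Longrightarrow> Pinv Y \<notin> V"
    using pow[of Y] P_eqI[of Y "Pinv Y"] unfolding powered_def Vstar_def by auto
qed

lemma has_ch_card_Zermelo: "U \<in> V \<Longrightarrow> has_ch_card U \<alpha> \<longleftrightarrow> \<alpha> = cardinality U"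
  unfolding has_ch_card_def by blast

lemma ch_card_Zermelo: "U \<in> V \<Longrightarrow> ch_card U = cardinality U"
  unfolding ch_card_def by (rule the_equality) (simp_all add: has_ch_card_Zermelo)

text \<open>A positive degree selects the branch with exponent degree minus one, which is
  \<open>k\<close>.\<close>

lemma has_ch_card_Pinv:
  assumes "Y \<in> Vstar" "\<not> powered Y" "has_degree Y (Suc k)"
  shows "has_ch_card (Pinv Y) (cardinality ((P ^^ k) NN))"
proof -
  have "Pinv Y \<in> EZF_class" using assms(1) unfolding EZF_class_def by blast
  then show ?thesis unfolding has_ch_card_def using assms Pinv_notin_V[OF assms(1,2)]
    by (intro disjI2 conjI bexI[of _ Y] exI[of _ "Suc k"]) auto
qed

lemma V_subset_EZF_class: "X \<in> V \<Longrightarrow> X \<in> EZF_class"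
  unfolding EZF_class_def by blast

text \<open>As \<open>Pinv Y\<close> is not in \<open>V\<close>, inclusion compares subset-members:
  those of \<open>A\<close> are the elements of \<open>P A\<close>, those of \<open>Pinv Y\<close>
  the elements of \<open>Y\<close>.\<close>

lemma Zermelo_ext_subset_Pinv:
  assumes "A \<in> V" "Y \<in> Vstar" "\<not> powered Y" "subs (P A) Y"
  shows "A \<sqsubseteq> Pinv Y"
  using assms Pinv_is_power[OF assms(2)] Pinv_notin_V[OF assms(2,3)] P_in_V_is_power[of A]
  unfolding ext_subset_def is_power_def subs_def by blast

lemma Pinv_ext_subset_Zermelo:
  assumes "A \<in> V" "Y \<in> Vstar" "\<not> powered Y" "subs Y (P A)"
  shows "Pinv Y \<sqsubseteq> A"
  using assms Pinv_is_power[OF assms(2)] Pinv_notin_V[OF assms(2,3)] P_in_V_is_power[of A]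
  unfolding ext_subset_def is_power_def subs_def by blast

text \<open>Non-Zermelo objects yield no new values: their CH-cardinality is that of an iterated
  powerset of \<open>NN\<close>.\<close>

lemma ch_cardinal_number_Zermelo:
  assumes "ch_cardinal_number \<beta>" obtains Y where "Y \<in> V" "\<beta> = cardinality Y"
proof -
  from assms obtain X where "has_ch_card X \<beta>" unfolding ch_cardinal_number_def by blast
  then show thesis unfolding has_ch_card_def
    using that NN(1) P_iterate_in_V[OF NN(1)] by (auto split: if_splits)
qed

section \<open>Comparability of cardinals\<close>

text \<open>
  Zermelo's tower argument, carried out with definable sets only.  The relation \<open>s\<close> assigns to a
  set at most one new element; towers are closed under arbitrary unions, not just unions of
  chains, so that being a tower does not refer to the order.
\<close>

definition extends_by :: "'u \<Rightarrow> 'u \<Rightarrow> 'u \<Rightarrow> bool" where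
  "extends_by s f g \<longleftrightarrow> (\<forall>z\<in>V. z \<epsilon> g \<longleftrightarrow> z \<epsilon> f \<or> maps s f z)"

definition is_union :: "'u \<Rightarrow> 'u \<Rightarrow> bool" where
  "is_union C u \<longleftrightarrow> (\<forall>z\<in>V. z \<epsilon> u \<longleftrightarrow> (\<exists>f\<in>V. f \<epsilon> C \<and> z \<epsilon> f))"

text \<open>No clause for a bottom element appears: the empty family \<open>C\<close> already forces
  the empty set into every tower.\<close>

definition tower :: "'u \<Rightarrow> 'u \<Rightarrow> bool" where
  "tower s T \<longleftrightarrow>
     (\<forall>f\<in>V. \<forall>g\<in>V. f \<epsilon> T \<and> extends_by s f g \<longrightarrow> g \<epsilon> T) \<and>
     (\<forall>C\<in>V. \<forall>u\<in>V. subs C T \<and> is_union C u \<longrightarrow> u \<epsilon> T)"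

lemma definable_extends_by [definable_intros]: "definable (\<lambda>e. extends_by (e i) (e j) (e k))"
  unfolding extends_by_def by (intro definable_intros)

lemma definable_is_union [definable_intros]: "definable (\<lambda>e. is_union (e i) (e j))"
  unfolding is_union_def by (intro definable_intros)

lemma definable_tower [definable_intros]: "definable (\<lambda>e. tower (e i) (e j))"
  unfolding tower_def by (intro definable_intros)

lemma subs_trans: "subs A B \<Longrightarrow> subs B C \<Longrightarrow> subs A C"
  unfolding subs_def by blast

lemma subs_antisym: "subs A B \<Longrightarrow> subs B A \<Longrightarrow> A \<in> V \<Longrightarrow> B \<in> V \<Longrightarrow> A = B"
  unfolding subs_def by (blast intro: set_eqI)

text \<open>\<open>M\<close> is the intersection of all towers. Its leastness acts as an induction
  principle: a property holds throughout \<open>M\<close> once the elements of \<open>M\<close>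
  having it form a tower.\<close>

lemma least_tower_is_chain:
  assumes V: "D \<in> V" "s \<in> V"
    and dom: "\<And>f z. f \<in> V \<Longrightarrow> z \<in> V \<Longrightarrow> maps s f z \<Longrightarrow> z \<epsilon> D"
    and single: "\<And>f z z'. f \<in> V \<Longrightarrow> z \<in> V \<Longrightarrow> z' \<in> V \<Longrightarrow> maps s f z \<Longrightarrow> maps s f z' \<Longrightarrow> z = z'"
  obtains M where "M \<in> V" "tower s M" "\<And>T. T \<in> V \<Longrightarrow> tower s T \<Longrightarrow> subs M T"
    "\<And>f. f \<epsilon> M \<Longrightarrow> subs f D" "\<And>f. f \<epsilon> M \<Longrightarrow> \<exists>g\<in>V. extends_by s f g"
    "\<And>f g. f \<epsilon> M \<Longrightarrow> g \<epsilon> M \<Longrightarrow> subs f g \<or> subs g f"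
proof -
  \<comment> \<open>Since \<open>P D\<close> is a tower, the intersection of all towers can be
    separated from it.\<close>
  have full: "tower s (P D)"
    using V dom unfolding tower_def by (auto simp: mem_P_iff subs_def extends_by_def is_union_def)
  have "\<exists>M\<in>V. \<forall>f\<in>V. f \<epsilon> M \<longleftrightarrow> f \<epsilon> P D \<and> (\<forall>T\<in>V. tower s T \<longrightarrow> f \<epsilon> T)"
    by (rule separation_definable[of "\<lambda>f s _ _ _ _. \<forall>T\<in>V. tower s T \<longrightarrow> f \<epsilon> T"])
       (use V in \<open>auto intro!: definable_intros\<close>)
  then obtain M where M: "M \<in> V" "\<And>f. f \<in> V \<Longrightarrow> f \<epsilon> M \<longleftrightarrow> (\<forall>T\<in>V. tower s T \<longrightarrow> f \<epsilon> T)"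
    using full by blast
  have least: "subs M T" if "T \<in> V" "tower s T" for T
    using M(2) that unfolding subs_def by blast
  have tow: "tower s M" unfolding tower_def
  proof (intro conjI ballI impI; elim conjE)
    fix f g assume "f \<in> V" "g \<in> V" "f \<epsilon> M" "extends_by s f g"
    then show "g \<epsilon> M" using M(2) unfolding tower_def by blast
  next
    fix C u assume u: "C \<in> V" "u \<in> V" "subs C M" "is_union C u"
    have "u \<epsilon> T" if "T \<in> V" "tower s T" for T
      using u subs_trans[OF u(3) least[OF that]] that(2) unfolding tower_def by blast
    then show "u \<epsilon> M" using M(2) u by blast
  qed
  have MD: "subs f D" "f \<in> V" if "f \<epsilon> M" for f
  proof -
    show "f \<in> V" using that M(1) transitivity by blast
    then show "subs f D" using M(2) full that V mem_P_iff P_in_V by blast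
  qed
  have ext_ex: "\<exists>g\<in>V. extends_by s f g" if "f \<epsilon> M" for f
  proof -
    have f: "f \<in> V" "subs f D" using MD that by auto
    have "\<exists>g\<in>V. \<forall>z\<in>V. z \<epsilon> g \<longleftrightarrow> z \<epsilon> D \<and> (z \<epsilon> f \<or> maps s f z)"
      by (rule separation_definable[of "\<lambda>z f s _ _ _. z \<epsilon> f \<or> maps s f z"])
         (use V f in \<open>auto intro!: definable_intros\<close>)
    then show ?thesis using f dom unfolding extends_by_def subs_def by blast
  qed
  \<comment> \<open>\<open>s\<close> is single-valued, so \<open>h\<close> has at most one element
    more than \<open>f\<close>.\<close>
  have ext_between: "g = f \<or> g = h"
    if "f \<in> V" "g \<in> V" "h \<in> V" "subs f g" "subs g h" "extends_by s f h" for f g h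
  proof (cases "\<exists>z\<in>V. z \<epsilon> g \<and> \<not> z \<epsilon> f")
    case True
    then obtain z where z: "z \<in> V" "z \<epsilon> g" "\<not> z \<epsilon> f" by blast
    then have "maps s f z" using that unfolding extends_by_def subs_def by blast
    then have "subs h g" using that z single unfolding extends_by_def subs_def by blast
    then show ?thesis using that subs_antisym by blast
  next
    case False
    then have "subs g f" unfolding subs_def by blast
    then show ?thesis using that subs_antisym by blast
  qed
  define comparable where
    "comparable c \<longleftrightarrow> (\<forall>x\<in>V. x \<epsilon> M \<longrightarrow> subs x c \<or> subs c x)" for c
  \<comment> \<open>Nothing in \<open>M\<close> lies strictly between a comparable \<open>c\<close>
    and its extension \<open>g\<close>, and all of \<open>M\<close> is comparable with this pair;
    proved by tower induction on \<open>x\<close>.\<close>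
  have split: "subs x c \<or> subs g x"
    if c: "c \<epsilon> M" "comparable c" "g \<in> V" "extends_by s c g" and x: "x \<epsilon> M" for c g x
  proof -
    have cV: "c \<in> V" using c MD by blast
    have "\<exists>T\<in>V. \<forall>x\<in>V. x \<epsilon> T \<longleftrightarrow> x \<epsilon> M \<and> (subs x c \<or> subs g x)"
      by (rule separation_definable[of "\<lambda>x c g _ _ _. subs x c \<or> subs g x"])
         (use M cV c in \<open>auto intro!: definable_intros\<close>)
    then obtain T where T: "T \<in> V" "\<And>x. x \<in> V \<Longrightarrow> x \<epsilon> T \<longleftrightarrow> x \<epsilon> M \<and> (subs x c \<or> subs g x)" by blast
    have "tower s T" unfolding tower_def
    proof (intro conjI ballI impI; elim conjE)
      fix y h assume h: "y \<in> V" "h \<in> V" "y \<epsilon> T" "extends_by s y h"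
      then have y: "y \<epsilon> M" "subs y c \<or> subs g y" using T by auto
      have hM: "h \<epsilon> M" using tow y h unfolding tower_def by blast
      have yh: "subs y h" using h unfolding extends_by_def subs_def by blast
      have "subs h c \<or> subs g h"
      proof (cases "subs g y")
        case True
        then show ?thesis using yh subs_trans by blast
      next
        case False
        with y have yc: "subs y c" by blast
        from c(2) hM h have "subs h c \<or> subs c h" unfolding comparable_def by blast
        then show ?thesis
        proof
          assume ch: "subs c h"
          \<comment> \<open>Here \<open>c\<close> lies between \<open>y\<close> and its extension
            \<open>h\<close>. If it equals \<open>y\<close>, then \<open>h\<close> and
            \<open>g\<close> extend the same set and have the same elements.\<close>
          from ext_between[OF h(1) cV h(2) yc ch h(4)]
          consider "c = y" | "c = h" by blast
          then show ?thesis
          proof cases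
            case 1
            then have "subs g h" using h(4) c(4) unfolding extends_by_def subs_def by blast
            then show ?thesis by blast
          next
            case 2
            then show ?thesis unfolding subs_def by blast
          qed
        qed blast
      qed
      then show "h \<epsilon> T" using T h hM by blast
    next
      fix C u assume u: "C \<in> V" "u \<in> V" "subs C T" "is_union C u"
      have CM: "subs C M" using u T unfolding subs_def by blast
      then have "u \<epsilon> M" using tow u unfolding tower_def by blast
      moreover have "subs u c \<or> subs g u"
      proof (cases "\<exists>y\<in>V. y \<epsilon> C \<and> subs g y")
        case True
        then show ?thesis using u(4) unfolding is_union_def subs_def by blast
      next
        case False
        then have "\<forall>y\<in>V. y \<epsilon> C \<longrightarrow> subs y c" using u(3) T unfolding subs_def[of C T] by blast
        then show ?thesis using u(4) unfolding is_union_def subs_def by blast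
      qed
      ultimately show "u \<epsilon> T" using T u by blast
    qed
    from least[OF T(1) this] show ?thesis using x T MD unfolding subs_def[of M T] by blast
  qed
  have comp: "comparable c" if "c \<epsilon> M" for c
  proof -
    \<comment> \<open>Second tower induction, now on \<open>c\<close>; the successor step is
      supplied by \<open>split\<close>.\<close>
    have "\<exists>T\<in>V. \<forall>c\<in>V. c \<epsilon> T \<longleftrightarrow> c \<epsilon> M \<and> (\<forall>x\<in>V. x \<epsilon> M \<longrightarrow> subs x c \<or> subs c x)"
      by (rule separation_definable[of "\<lambda>c M _ _ _ _. \<forall>x\<in>V. x \<epsilon> M \<longrightarrow> subs x c \<or> subs c x"])
         (use M in \<open>auto intro!: definable_intros\<close>)
    then obtain T where T: "T \<in> V" "\<And>c. c \<in> V \<Longrightarrow> c \<epsilon> T \<longleftrightarrow> c \<epsilon> M \<and> comparable c"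
      unfolding comparable_def by blast
    have "tower s T" unfolding tower_def
    proof (intro conjI ballI impI; elim conjE)
      fix f g assume g: "f \<in> V" "g \<in> V" "f \<epsilon> T" "extends_by s f g"
      then have f: "f \<epsilon> M" "comparable f" using T by auto
      have "subs f g" using g unfolding extends_by_def subs_def by blast
      then have "comparable g" unfolding comparable_def
        using split[OF f g(2,4)] subs_trans by blast
      moreover have "g \<epsilon> M" using tow g f unfolding tower_def by blast
      ultimately show "g \<epsilon> T" using T g by blast
    next
      fix C u assume u: "C \<in> V" "u \<in> V" "subs C T" "is_union C u"
      have CM: "subs C M" using u T unfolding subs_def by blast
      then have "u \<epsilon> M" using tow u unfolding tower_def by blast
      moreover have "subs x u \<or> subs u x" if x: "x \<in> V" "x \<epsilon> M" for x
      proof (cases "\<exists>y\<in>V. y \<epsilon> C \<and> subs x y")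
        case True
        then show ?thesis using u(4) unfolding is_union_def subs_def by blast
      next
        case False
        then have "\<forall>y\<in>V. y \<epsilon> C \<longrightarrow> subs y x"
          using u(3) T x unfolding subs_def[of C T] comparable_def by blast
        then show ?thesis using u(4) unfolding is_union_def subs_def by blast
      qed
      ultimately show "u \<epsilon> T" using T u unfolding comparable_def by blast
    qed
    from least[OF T(1) this] show ?thesis using that T MD unfolding subs_def by blast
  qed
  show thesis
    by (rule that[OF M(1) tow least MD(1) ext_ex]) (use comp MD in \<open>auto simp: comparable_def\<close>)
qed

end

context EZFC
begin

text \<open>The family of fibers \<open>{x} \<times> r(x)\<close> is disjoint, so the axiom of choice applies to it.\<close>

lemma uniformization:
  assumes r: "r \<in> V"
  obtains s where "s \<in> V"
    "\<And>x y. x \<in> V \<Longrightarrow> y \<in> V \<Longrightarrow> maps s x y \<Longrightarrow> maps r x y"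
    "\<And>x y y'. x \<in> V \<Longrightarrow> y \<in> V \<Longrightarrow> y' \<in> V \<Longrightarrow> maps s x y \<Longrightarrow> maps s x y' \<Longrightarrow> y = y'"
    "\<And>x y. x \<in> V \<Longrightarrow> y \<in> V \<Longrightarrow> maps r x y \<Longrightarrow> \<exists>y\<in>V. maps s x y"
proof -
  define fiber where
    "fiber r x K \<longleftrightarrow> (\<forall>p\<in>V. p \<epsilon> K \<longleftrightarrow> p \<epsilon> r \<and> (\<exists>y\<in>V. is_opair x y p))" for r x K
  \<comment> \<open>Empty fibers are excluded, as choice requires non-empty members.\<close>
  have "\<exists>F\<in>V. \<forall>K\<in>V. K \<epsilon> F \<longleftrightarrow>
      K \<epsilon> P r \<and> (\<exists>p\<in>V. p \<epsilon> K) \<and> (\<exists>x\<in>V. fiber r x K)"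
    by (rule separation_definable[of "\<lambda>K r _ _ _ _. (\<exists>p\<in>V. p \<epsilon> K) \<and> (\<exists>x\<in>V. fiber r x K)"])
       (use r in \<open>auto intro!: definable_intros simp: fiber_def\<close>)
  then obtain F where F: "F \<in> V" "\<And>K. K \<in> V \<Longrightarrow> K \<epsilon> F \<longleftrightarrow>
      K \<epsilon> P r \<and> (\<exists>p\<in>V. p \<epsilon> K) \<and> (\<exists>x\<in>V. fiber r x K)" by blast
  have disj: "A = B" if AB: "A \<in> V" "B \<in> V" "A \<epsilon> F" "B \<epsilon> F" "p \<in> V" "p \<epsilon> A" "p \<epsilon> B" for A B p
  proof -
    obtain x x' where x: "x \<in> V" "x' \<in> V" "fiber r x A" "fiber r x' B"
      using F(2)[OF AB(1)] F(2)[OF AB(2)] AB(3,4) by blast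
    then obtain y y' where "y \<in> V" "y' \<in> V" "is_opair x y p" "is_opair x' y' p"
      using AB unfolding fiber_def by blast
    then have "x = x'" using x AB by (simp add: is_opair_iff opair_eq_iff)
    then show ?thesis using x AB unfolding fiber_def by (intro set_eqI) blast+
  qed
  have "\<exists>C\<in>V. \<forall>A\<in>V. A \<epsilon> F \<longrightarrow> (\<exists>!x. x \<in> V \<and> x \<epsilon> A \<and> x \<epsilon> C)"
    using choice[rule_format, OF F(1)] F(2) disj by blast
  then obtain C where C: "C \<in> V" "\<And>A. A \<in> V \<Longrightarrow> A \<epsilon> F \<Longrightarrow> \<exists>!p. p \<in> V \<and> p \<epsilon> A \<and> p \<epsilon> C" by blast
  \<comment> \<open>The transversal may contain more than the chosen pairs; within \<open>r\<close>
    it meets each non-empty fiber exactly once.\<close>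
  have "\<exists>s\<in>V. \<forall>p\<in>V. p \<epsilon> s \<longleftrightarrow> p \<epsilon> r \<and> p \<epsilon> C"
    by (rule separation_definable[of "\<lambda>p C _ _ _ _. p \<epsilon> C"])
       (use r C in \<open>auto intro!: definable_intros\<close>)
  then obtain s where s: "s \<in> V" "\<And>p. p \<in> V \<Longrightarrow> p \<epsilon> s \<longleftrightarrow> p \<epsilon> r \<and> p \<epsilon> C" by blast
  have ms: "maps s x y \<longleftrightarrow> opair x y \<epsilon> r \<and> opair x y \<epsilon> C" if "x \<in> V" "y \<in> V" for x y
    using that s by (simp add: maps_iff)
  have fib: "\<exists>K\<in>V. K \<epsilon> F \<and> fiber r x K" if "x \<in> V" "y \<in> V" "opair x y \<epsilon> r" for x y
  proof -
    have "\<exists>K\<in>V. \<forall>p\<in>V. p \<epsilon> K \<longleftrightarrow> p \<epsilon> r \<and> (\<exists>y\<in>V. is_opair x y p)"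
      by (rule separation_definable[of "\<lambda>p x _ _ _ _. \<exists>y\<in>V. is_opair x y p"])
         (use r that in \<open>auto intro!: definable_intros\<close>)
    then obtain K where K: "K \<in> V" "fiber r x K" unfolding fiber_def by blast
    then have "K \<epsilon> P r" using r unfolding fiber_def by (auto simp: mem_P_iff subs_def)
    moreover have "opair x y \<epsilon> K" "opair x y \<in> V"
      using K that unfolding fiber_def by (auto simp: is_opair_iff)
    ultimately show ?thesis using F K that(1) by blast
  qed
  show thesis
  proof (rule that[OF s(1)])
    show "maps r x y" if "x \<in> V" "y \<in> V" "maps s x y" for x y
      using that ms by (simp add: maps_iff)
  next
    fix x y y' assume xy: "x \<in> V" "y \<in> V" "y' \<in> V" "maps s x y" "maps s x y'"
    then have p: "opair x y \<epsilon> r" "opair x y \<epsilon> C" "opair x y' \<epsilon> r" "opair x y' \<epsilon> C" using ms by auto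
    with fib xy obtain K where K: "K \<in> V" "K \<epsilon> F" "fiber r x K" by blast
    have "opair x y \<epsilon> K" "opair x y' \<epsilon> K"
      using K(3) p xy unfolding fiber_def by (auto simp: is_opair_iff)
    then have "opair x y = opair x y'" using C(2)[OF K(1,2)] p xy opair_in_V by blast
    then show "y = y'" using xy by (simp add: opair_eq_iff)
  next
    fix x y assume xy: "x \<in> V" "y \<in> V" "maps r x y"
    then obtain K where K: "K \<in> V" "K \<epsilon> F" "fiber r x K" using fib maps_iff by blast
    then obtain p where p: "p \<in> V" "p \<epsilon> K" "p \<epsilon> C" using C(2) by blast
    then obtain z where "z \<in> V" "p = opair x z" "p \<epsilon> r"
      using K(3) xy unfolding fiber_def by (auto simp: is_opair_iff)
    then show "\<exists>y\<in>V. maps s x y" using p ms xy by blast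
  qed
qed

text \<open>
  The chain of partial injections obtained by repeatedly adding a chosen pair ends in one that
  is total or onto.
\<close>

lemma card_le_total:
  assumes V: "X \<in> V" "Y \<in> V"
  shows "card_le X Y \<or> card_le Y X"
proof -
  obtain D where D: "D \<in> V" "\<And>p. p \<epsilon> D \<longleftrightarrow> (\<exists>x y. x \<epsilon> X \<and> y \<epsilon> Y \<and> p = opair x y)"
    by (rule relation_exists[of "\<lambda>_ _ _ _ _. True" X Y X X X])
       (use V in \<open>auto intro!: definable_intros\<close>)
  define free where "free f q \<longleftrightarrow> (\<exists>x\<in>V. \<exists>y\<in>V. is_opair x y q \<and>
    \<not> (\<exists>y'\<in>V. maps f x y') \<and> \<not> (\<exists>x'\<in>V. maps f x' y))" for f q
  obtain r where r: "r \<in> V"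
    "\<And>f q. f \<in> V \<Longrightarrow> q \<in> V \<Longrightarrow> maps r f q \<longleftrightarrow> f \<epsilon> P D \<and> q \<epsilon> D \<and> free f q"
    by (rule relation_exists[of "\<lambda>f q _ _ _. free f q" "P D" D D D D])
       (use D in \<open>auto intro!: definable_intros simp: free_def\<close>)
  obtain s where s: "s \<in> V"
    "\<And>f q. f \<in> V \<Longrightarrow> q \<in> V \<Longrightarrow> maps s f q \<Longrightarrow> maps r f q"
    "\<And>f q q'. f \<in> V \<Longrightarrow> q \<in> V \<Longrightarrow> q' \<in> V \<Longrightarrow> maps s f q \<Longrightarrow> maps s f q' \<Longrightarrow> q = q'"
    "\<And>f q. f \<in> V \<Longrightarrow> q \<in> V \<Longrightarrow> maps r f q \<Longrightarrow> \<exists>q\<in>V. maps s f q"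
    using uniformization[OF r(1)] by blast
  have dom: "z \<epsilon> D" if "f \<in> V" "z \<in> V" "maps s f z" for f z
    using s(2)[OF that] r(2) that by blast
  obtain M where M: "M \<in> V" "tower s M" "\<And>T. T \<in> V \<Longrightarrow> tower s T \<Longrightarrow> subs M T"
    "\<And>f. f \<epsilon> M \<Longrightarrow> subs f D" "\<And>f. f \<epsilon> M \<Longrightarrow> \<exists>g\<in>V. extends_by s f g"
    "\<And>f g. f \<epsilon> M \<Longrightarrow> g \<epsilon> M \<Longrightarrow> subs f g \<or> subs g f"
    by (rule least_tower_is_chain[of D s], rule D(1), rule s(1), (rule dom; assumption),
        (rule s(3); assumption), (rule that; assumption))
  \<comment> \<open>The equivalence expresses single-valuedness and injectivity at once.\<close>
  define pinj where "pinj f \<longleftrightarrow> (\<forall>x\<in>V. \<forall>y\<in>V. \<forall>x'\<in>V. \<forall>y'\<in>V.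
    maps f x y \<and> maps f x' y' \<longrightarrow> (x = x' \<longleftrightarrow> y = y'))" for f
  have "\<exists>T\<in>V. \<forall>f\<in>V. f \<epsilon> T \<longleftrightarrow> f \<epsilon> M \<and> pinj f"
    by (rule separation_definable[of "\<lambda>f _ _ _ _ _. pinj f"])
       (use M in \<open>auto intro!: definable_intros simp: pinj_def\<close>)
  then obtain T where T: "T \<in> V" "\<And>f. f \<in> V \<Longrightarrow> f \<epsilon> T \<longleftrightarrow> f \<epsilon> M \<and> pinj f" by blast
  have "tower s T" unfolding tower_def
  proof (intro conjI ballI impI; elim conjE)
    fix f g assume g: "f \<in> V" "g \<in> V" "f \<epsilon> T" "extends_by s f g"
    then have f: "f \<epsilon> M" "pinj f" using T by auto
    have mg: "maps g x y \<longleftrightarrow> maps f x y \<or> maps s f (opair x y)" if "x \<in> V" "y \<in> V" for x y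
      using that g(4) by (simp add: maps_iff extends_by_def)
    have new: "\<not> maps f x y'" "\<not> maps f x' y"
      if "x \<in> V" "y \<in> V" "x' \<in> V" "y' \<in> V" "maps s f (opair x y)" for x y x' y'
    proof -
      have "opair x y \<in> V" using that by simp
      with that s(2) r(2) g(1) have "free f (opair x y)" by meson
      then obtain x1 y1 where 1: "x1 \<in> V" "y1 \<in> V" "is_opair x1 y1 (opair x y)"
        "\<not> (\<exists>y'\<in>V. maps f x1 y')" "\<not> (\<exists>x'\<in>V. maps f x' y1)"
        unfolding free_def by blast
      then have "x1 = x" "y1 = y" using that by (auto simp: is_opair_iff opair_eq_iff)
      with 1 that show "\<not> maps f x y'" "\<not> maps f x' y" by auto
    qed
    have "pinj g" unfolding pinj_def
    proof (intro ballI impI; elim conjE)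
      fix x y x' y' assume xy: "x \<in> V" "y \<in> V" "x' \<in> V" "y' \<in> V" "maps g x y" "maps g x' y'"
      then consider "maps f x y" "maps f x' y'" | "maps f x y" "maps s f (opair x' y')"
        | "maps s f (opair x y)" "maps f x' y'" | "maps s f (opair x y)" "maps s f (opair x' y')"
        using mg by blast
      then show "x = x' \<longleftrightarrow> y = y'"
      proof cases
        case 1
        then show ?thesis using f(2) xy unfolding pinj_def by blast
      next
        case 4
        then have "opair x y = opair x' y'"
          using s(3)[OF g(1) opair_in_V[OF xy(1,2)] opair_in_V[OF xy(3,4)]] by blast
        then show ?thesis using xy by (simp add: opair_eq_iff)
      qed (use new xy in blast)+
    qed
    moreover have "g \<epsilon> M" using M(2) f g unfolding tower_def by blast
    ultimately show "g \<epsilon> T" using T g by blast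
  next
    fix C u assume u: "C \<in> V" "u \<in> V" "subs C T" "is_union C u"
    have "subs C M" using u T unfolding subs_def by blast
    then have "u \<epsilon> M" using M(2) u unfolding tower_def by blast
    moreover have "pinj u" unfolding pinj_def
    proof (intro ballI impI; elim conjE)
      fix x y x' y' assume xy: "x \<in> V" "y \<in> V" "x' \<in> V" "y' \<in> V" "maps u x y" "maps u x' y'"
      then obtain f g where fg: "f \<in> V" "g \<in> V" "f \<epsilon> C" "g \<epsilon> C" "maps f x y" "maps g x' y'"
        using u(4) opair_in_V unfolding is_union_def by (simp add: maps_iff) blast
      then have fgT: "f \<epsilon> M" "g \<epsilon> M" "pinj f" "pinj g" using u(3) T unfolding subs_def by auto
      \<comment> \<open>As \<open>M\<close> is a chain, the larger of \<open>f\<close> and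
        \<open>g\<close> contains both pairs.\<close>
      from M(6)[OF fgT(1,2)] show "x = x' \<longleftrightarrow> y = y'"
      proof
        assume "subs f g"
        then have "maps g x y" using fg(5) xy unfolding subs_def by (simp add: maps_iff)
        with fg fgT xy show ?thesis unfolding pinj_def by blast
      next
        assume "subs g f"
        then have "maps f x' y'" using fg(6) xy unfolding subs_def by (simp add: maps_iff)
        with fg fgT xy show ?thesis unfolding pinj_def by blast
      qed
    qed
    ultimately show "u \<epsilon> T" using T u by blast
  qed
  then have pinj: "pinj f" if "f \<epsilon> M" for f
    using M(3)[OF T(1)] that T M(1) transitivity unfolding subs_def by blast
  from union M(1) obtain m
    where "m \<in> V" "\<forall>x\<in>V. x \<epsilon> m \<longleftrightarrow> (\<exists>f\<in>V. x \<epsilon> f \<and> f \<epsilon> M)" by blast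
  then have m: "m \<in> V" "is_union M m" unfolding is_union_def by auto
  \<comment> \<open>\<open>M\<close> is a subfamily of itself, so closure under unions gives it a
    largest element.\<close>
  have mM: "m \<epsilon> M" using M(1,2) m unfolding tower_def subs_def by blast
  have mD: "m \<epsilon> P D" using M(4)[OF mM] m D by (simp add: mem_P_iff)
  have mXY: "x \<epsilon> X \<and> y \<epsilon> Y" if "x \<in> V" "y \<in> V" "maps m x y" for x y
  proof -
    have "opair x y \<epsilon> D" using M(4)[OF mM] that unfolding subs_def by (simp add: maps_iff)
    then show ?thesis using D(2) that V transitivity by (auto simp: opair_eq_iff)
  qed
  \<comment> \<open>An extension of \<open>m\<close> by \<open>q\<close> would belong to
    \<open>M\<close> and so be contained in \<open>m\<close>; but then \<open>q\<close> would not be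
    free for \<open>m\<close>.\<close>
  have max: "\<not> maps s m q" if q: "q \<in> V" for q
  proof
    assume sq: "maps s m q"
    obtain g where g: "g \<in> V" "extends_by s m g" using M(5)[OF mM] by blast
    then have "g \<epsilon> M" using M(2) m(1) mM unfolding tower_def by blast
    moreover have "q \<epsilon> g" using g sq q unfolding extends_by_def by blast
    ultimately have "q \<epsilon> m" using m q g unfolding is_union_def by blast
    moreover have "free m q" using s(2) r(2) m q sq by blast
    ultimately show False using q unfolding free_def by (auto simp: is_opair_iff maps_iff)
  qed
  have cover: "(\<exists>y'\<in>V. maps m x y') \<or> (\<exists>x'\<in>V. maps m x' y)" if xy: "x \<epsilon> X" "y \<epsilon> Y" for x y
  proof (rule ccontr)
    assume no: "\<not> ?thesis"
    have xyV: "x \<in> V" "y \<in> V" using xy V transitivity by blast+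
    then have "free m (opair x y)" unfolding free_def using no
      by (intro bexI[of _ x] bexI[of _ y]) (auto simp: is_opair_iff)
    moreover have "opair x y \<epsilon> D" using D xy by blast
    ultimately have "maps r m (opair x y)" using r(2) m mD xyV by simp
    then show False using s(4) max m xyV opair_in_V by blast
  qed
  have inj: "x = x' \<longleftrightarrow> y = y'"
    if "x \<in> V" "y \<in> V" "x' \<in> V" "y' \<in> V" "maps m x y" "maps m x' y'" for x y x' y'
    using pinj[OF mM] that unfolding pinj_def by blast
  show ?thesis
  proof (cases "\<forall>x\<in>V. x \<epsilon> X \<longrightarrow> (\<exists>y\<in>V. maps m x y)")
    case True
    have "card_le X Y"
    proof (rule card_le_definable[of "\<lambda>x y m _ _. maps m x y" X Y m m m])
      show "\<exists>y. y \<epsilon> Y \<and> maps m x y" if "x \<epsilon> X" for x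
        using that True mXY V transitivity by blast
      show "y = y'" if "x \<epsilon> X" "y \<epsilon> Y" "y' \<epsilon> Y" "maps m x y" "maps m x y'" for x y y'
        using that inj[of x y x y'] V transitivity by blast
      show "x = x'" if "x \<epsilon> X" "x' \<epsilon> X" "y \<epsilon> Y" "maps m x y" "maps m x' y" for x x' y
        using that inj[of x y x' y] V transitivity by blast
    qed (use V m in \<open>auto intro!: definable_intros\<close>)
    then show ?thesis ..
  next
    case False
    \<comment> \<open>Some element of \<open>X\<close> lies outside the domain of \<open>m\<close>;
      \<open>cover\<close> for it puts every element of \<open>Y\<close> into the range.\<close>
    then have all: "\<exists>x\<in>V. maps m x y" if "y \<epsilon> Y" for y using cover that by blast
    have "card_le Y X"
    proof (rule card_le_definable[of "\<lambda>y x m _ _. maps m x y" Y X m m m])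
      show "\<exists>x. x \<epsilon> X \<and> maps m x y" if "y \<epsilon> Y" for y
        using that all mXY V transitivity by blast
      show "x = x'" if "y \<epsilon> Y" "x \<epsilon> X" "x' \<epsilon> X" "maps m x y" "maps m x' y" for x x' y
        using that inj[of x y x' y] V transitivity by blast
      show "y = y'" if "y \<epsilon> Y" "y' \<epsilon> Y" "x \<epsilon> X" "maps m x y" "maps m x y'" for x y y'
        using that inj[of x y x y'] V transitivity by blast
    qed (use V m in \<open>auto intro!: definable_intros\<close>)
    then show ?thesis ..
  qed
qed

section \<open>The continuum hypothesis for CH-cardinals\<close>

lemma ch_leI:
  assumes "A \<in> EZF_class" "B \<in> EZF_class" "C \<in> EZF_class"
    and "has_ch_card A \<alpha>" "has_ch_card C \<alpha>" "has_ch_card B \<beta>" "C \<sqsubseteq> B"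
  shows "ch_le \<alpha> \<beta>"
  using assms unfolding ch_le_def ch_preceq_def by blast

lemma ch_le_if_card_le:
  assumes "card_le X Y" and V: "X \<in> V" "Y \<in> V"
  shows "ch_le (cardinality X) (cardinality Y)"
proof -
  obtain C where C: "C \<in> V" "subs C Y" "equipotent X C" using equipotent_subset assms by blast
  show ?thesis
    by (rule ch_leI[of X Y C])
       (use C V cardinality_eqI[OF C(3)] in
         \<open>auto simp: has_ch_card_Zermelo V_subset_EZF_class ext_subset_def subs_def\<close>)
qed

text \<open>As \<open>ch_less\<close> demands failure of the reverse \<open>ch_le\<close>, the first
  alternative refutes that |Y| is above \<open>aleph0\<close>, the second that it is below
  \<open>continuum\<close>.\<close>

lemma ch_le_aleph0_or_continuum_le:
  assumes Y: "Y \<in> V"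
  shows "ch_le (cardinality Y) (cardinality NN) \<or> ch_le (cardinality (P NN)) (cardinality Y)"
proof (rule ccontr)
  assume neg: "\<not> ?thesis"
  then have YN: "\<not> card_le Y NN" and NY: "\<not> card_le (P NN) Y"
    using ch_le_if_card_le Y NN(1) by blast+
  then have NleY: "card_le NN Y" and YleP: "card_le Y (P NN)"
    using card_le_total Y NN(1) P_in_V by blast+
  obtain e where e: "e \<in> V" "is_empty e" using null_set by blast
  have ne: "\<not> is_empty Y"
  proof
    assume "is_empty Y"
    then have "subs Y NN" using Y unfolding is_empty_def subs_def by blast
    with YN card_le_subs Y NN(1) show False by blast
  qed
  have YP: "Y \<epsilon> P Y" using Y by (simp add: mem_P_iff subs_def)
  show False
  proof (cases "card_le (P Y) (P NN)")
    case True
    define z where "z = upair Y Y"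
    have z: "z \<in> V" "\<And>x. x \<epsilon> z \<longleftrightarrow> x = Y" using Y by (auto simp: z_def upair_in_V mem_upair_iff)
    have "upair z z \<in> V" using z by (simp add: upair_in_V)
    then obtain X where X: "X \<in> V" "\<forall>x\<in>V. x \<epsilon> X \<longleftrightarrow> x \<epsilon> P Y \<or> x \<epsilon> upair z z"
      using union2_exists[OF P_in_V] by blast
    then have X': "\<And>x. x \<epsilon> X \<longleftrightarrow> x \<epsilon> P Y \<or> x = z"
      using z(1) transitivity[OF P_in_V] transitivity[OF X(1)] by (auto simp: mem_upair_iff)
    have sub: "subs (P Y) X" using X' unfolding subs_def by blast
    have Vs: "X \<in> Vstar" using X X' YP Y unfolding Vstar_def is_empty_def by blast
    have np: "\<not> powered X"
    proof
      assume "powered X"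
      then obtain W where W: "W \<in> V" "X = P W" unfolding powered_def by blast
      \<comment> \<open>\<open>W\<close> is itself in \<open>X\<close>, so it is a subset of
        \<open>Y\<close> or equal to \<open>{Y}\<close>. The first puts \<open>Y\<close> into
        \<open>Y\<close>; so does the second, because then the non-empty \<open>Y\<close> is a
        subset of \<open>{Y}\<close>.\<close>
      have "Y \<epsilon> P W" "z \<epsilon> P W" "W \<epsilon> P W"
        using X'[of Y] X'[of z] YP W by (simp_all add: mem_P_iff subs_def)
      then have sW: "subs Y W" "subs z W" and "W \<epsilon> P Y \<or> W = z"
        using Y z W X'[of W] by (simp_all add: mem_P_iff)
      then consider "subs W Y" | "W = z" using W Y by (auto simp: mem_P_iff)
      then show False
      proof cases
        case 1
        then have "Y \<epsilon> Y" using sW(2) z Y unfolding subs_def by blast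
        then show False using mem_irrefl Y by blast
      next
        case 2
        then have "\<forall>x\<in>V. x \<epsilon> Y \<longrightarrow> x = Y" using sW(1) z unfolding subs_def by blast
        then show False using mem_irrefl Y ne unfolding is_empty_def by blast
      qed
    qed
    have YX: "card_le Y X"
      using card_le_trans[OF card_le_P card_le_subs[OF _ _ sub]] Y X P_in_V by blast
    have "\<not> equipotent NN X"
      using YX YN card_le_trans[of Y X NN] equipotent_imp_card_le equipotent_sym[of NN X]
        Y X(1) NN(1) by blast
    \<comment> \<open>The lower bound comes through \<open>Y\<close>; the upper bound is that of
      \<open>P Y\<close>, which survives the extra element \<open>z\<close>.\<close>
    then have "has_degree X (Suc 0)"
      using card_le_trans[OF NleY YX] card_le_insert[OF True P_in_V z(1) X(1)] X' NN(1) Y X(1)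
      unfolding has_degree.simps card_less_def by simp
    from has_ch_card_Pinv[OF Vs np this]
    have "has_ch_card (Pinv X) (cardinality NN)" by simp
    then have "ch_le (cardinality Y) (cardinality NN)"
      using Zermelo_ext_subset_Pinv[OF Y Vs np sub] Y Vs
      by (intro ch_leI[of Y "Pinv X" Y])
         (auto simp: has_ch_card_Zermelo V_subset_EZF_class EZF_class_def)
    with neg show False by blast
  next
    case False
    have "\<exists>Z\<in>V. \<forall>A\<in>V. A \<epsilon> Z \<longleftrightarrow> A \<epsilon> P Y \<and> \<not> is_empty A"
      by (rule separation_definable[of "\<lambda>A _ _ _ _ _. \<not> is_empty A"])
         (use Y in \<open>auto intro!: definable_intros\<close>)
    then obtain Z where Z: "Z \<in> V" "\<And>A. A \<in> V \<Longrightarrow> A \<epsilon> Z \<longleftrightarrow> A \<epsilon> P Y \<and> \<not> is_empty A" by blast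
    have sub: "subs Z (P Y)" using Z unfolding subs_def by blast
    have "Y \<epsilon> Z" using Z(2)[OF Y] YP ne by blast
    then have Vs: "Z \<in> Vstar" using Z(1) Y unfolding Vstar_def is_empty_def by blast
    have np: "\<not> powered Z"
    proof
      assume "powered Z"
      then obtain W where W: "W \<in> V" "Z = P W" unfolding powered_def by blast
      \<comment> \<open>Every powerset contains the empty set, which was removed from
        \<open>Z\<close>.\<close>
      have "e \<epsilon> P W" using e W by (simp add: mem_P_iff subs_def is_empty_def)
      then show False using Z(2) e W by blast
    qed
    have "x \<epsilon> Z \<or> x = e" if "x \<epsilon> P Y" for x
    proof -
      have x: "x \<in> V" using that transitivity P_in_V by blast
      have "is_empty x \<Longrightarrow> x = e" using x e unfolding is_empty_def by (intro set_eqI) auto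
      with Z(2)[OF x] that show ?thesis by blast
    qed
    \<comment> \<open>Restoring the empty set to an embeddable \<open>Z\<close> would embed
      \<open>P Y\<close> into \<open>P NN\<close>, against the case assumption.\<close>
    then have ZN: "\<not> card_le Z (P NN)" using False card_le_insert[OF _ Z(1) e(1) P_in_V] by blast
    then have "card_le (P NN) Z" using card_le_total Z(1) P_in_V by blast
    moreover have "\<not> equipotent (P NN) Z"
      using ZN equipotent_imp_card_le equipotent_sym[of "P NN" Z] Z(1) P_in_V by blast
    moreover have "card_le Z (P (P NN))"
      using card_le_trans[OF card_le_subs[OF _ _ sub] card_le_P_mono[OF YleP]] Z(1) Y P_in_V by blast
    ultimately have "has_degree Z (Suc (Suc 0))" by (simp add: card_less_def)
    from has_ch_card_Pinv[OF Vs np this]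
    have "has_ch_card (Pinv Z) (cardinality (P NN))" by simp
    then have "ch_le (cardinality (P NN)) (cardinality Y)"
      using Pinv_ext_subset_Zermelo[OF Y Vs np sub] Y Vs
      \<comment> \<open>The copy of the continuum included in \<open>Y\<close> is the non-Zermelo
        object \<open>Pinv Z\<close>.\<close>
      by (intro ch_leI[of "P NN" Y "Pinv Z"])
         (auto simp: has_ch_card_Zermelo V_subset_EZF_class EZF_class_def)
    with neg show False by blast
  qed
qed

end

theorem theorem2:
  fixes V :: "'u set" and mem mem1 :: "'u \<Rightarrow> 'u \<Rightarrow> bool"
  assumes "EZFC V mem mem1"
  shows "\<not> (\<exists>\<beta>. EZF_language.ch_cardinal_number V mem mem1 \<beta> \<and>
            EZF_language.ch_less V mem mem1 (EZF_language.aleph0 V mem mem1) \<beta> \<and>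
            EZF_language.ch_less V mem mem1 \<beta> (EZF_language.continuum V mem mem1))"
proof -
  interpret EZFC V mem mem1 by fact
  show ?thesis
    using ch_le_aleph0_or_continuum_le ch_cardinal_number_Zermelo
    unfolding ch_less_def aleph0_def continuum_def ch_card_Zermelo[OF NN(1)] ch_card_Zermelo[OF P_in_V]
    by metis
qed

end
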